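(* Let $\Bbbk$ be a field of characteristic different from two. Let $f\colon\mathbb{N}\rightarrow\mathbb{N}$ be an increasing, polynomially bounded function such that $f(n)\succeq n^2$. Then there exists a finitely generated associative $\Bbbk$-algebra $A$, satisfying a polynomial identity, such that $\gamma_A(n)\sim f(n)$.
   Context: Growth functions: if $A$ is a $\Bbbk$-algebra generated by a finite set $X$, let $X^{\leq n}$ be the set of all products of at most $n$ elements of $X$, and put $\gamma_{A,X}(n)=\dim_\Bbbk \operatorname{Span}_\Bbbk X^{\leq n}$ for $n\geq 1$. Asymptotic equivalence: for non-decreasing functions $f,g$ on the positive integers with values in the non-negative integers, $f\preceq g$ (equivalently $g\succeq f$) means that there are positive constants $C,D$ (with $D$ an integer) such that $f(n)\leq C g(Dn)$ for all $n\geq 1$; $f\sim g$ means $f\preceq g$ and $g\preceq f$. The $\sim$-class of $\gamma_{A,X}$ does not depend on the finite generating set $X$; one writes $\gamma_A$ for $\gamma_{A,X}$ with any choice of $X$. "Increasing" means strictly increasing. "Polynomially bounded" means that $f(n)\leq Kn^d$ for all $n\geq 1$, for some constants $K,d>0$. Functions are considered with arguments $n\geq 1$. "Satisfying a polynomial identity" means that some non-zero polynomial in non-commuting variables over $\Bbbk$ vanishes under all substitutions of elements of $A$. *)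

theory Defs
  imports Complex_Main "HOL-Algebra.Algebra"
begin

section \<open>Growth types of functions on the positive integers\<close>

text \<open>Functions are only considered at arguments \<open>n \<ge> 1\<close>; the value at \<open>0\<close> is never used.\<close>

definition growth_le :: "(nat \<Rightarrow> nat) \<Rightarrow> (nat \<Rightarrow> nat) \<Rightarrow> bool"  (infix \<open>\<preceq>\<^sub>g\<close> 50)
  where "f \<preceq>\<^sub>g g \<longleftrightarrow>
    (\<exists>C::real. \<exists>D::nat. C > 0 \<and> D > 0 \<and> (\<forall>n\<ge>1. real (f n) \<le> C * real (g (D * n))))"

definition growth_equiv :: "(nat \<Rightarrow> nat) \<Rightarrow> (nat \<Rightarrow> nat) \<Rightarrow> bool"  (infix \<open>\<sim>\<^sub>g\<close> 50)
  where "f \<sim>\<^sub>g g \<longleftrightarrow> f \<preceq>\<^sub>g g \<and> g \<preceq>\<^sub>g f"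

definition polynomially_bounded :: "(nat \<Rightarrow> nat) \<Rightarrow> bool"
  where "polynomially_bounded f \<longleftrightarrow>
    (\<exists>K::real. \<exists>d::real. K > 0 \<and> d > 0 \<and> (\<forall>n\<ge>1. real (f n) \<le> K * real n powr d))"


section \<open>Associative algebras\<close>

text \<open>The additive order of \<open>\<one>\<close>; the library's \<open>group.ord\<close> is \<open>0\<close> for infinite order.\<close>

definition characteristic :: "('k, 'm) ring_scheme \<Rightarrow> nat"
  where "characteristic K = group.ord (add_monoid K) \<one>\<^bsub>K\<^esub>"

text \<open>The library's locale \<open>algebra\<close> requires a commutative multiplication. This is
  the non-commutative analogue for associative algebras with unit, so the
  compatibility of scalars with the multiplication is needed on both sides.\<close>

locale assoc_algebra = module + ring M +
  assumes smult_mult_left: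
      "\<lbrakk> a \<in> carrier R; x \<in> carrier M; y \<in> carrier M \<rbrakk> \<Longrightarrow>
       (a \<odot>\<^bsub>M\<^esub> x) \<otimes>\<^bsub>M\<^esub> y = a \<odot>\<^bsub>M\<^esub> (x \<otimes>\<^bsub>M\<^esub> y)"
    and smult_mult_right:
      "\<lbrakk> a \<in> carrier R; x \<in> carrier M; y \<in> carrier M \<rbrakk> \<Longrightarrow>
       x \<otimes>\<^bsub>M\<^esub> (a \<odot>\<^bsub>M\<^esub> y) = a \<odot>\<^bsub>M\<^esub> (x \<otimes>\<^bsub>M\<^esub> y)"

text \<open>The copy of the ground field inside the algebra. The library's \<open>ring.Span\<close> and
  \<open>ring.dim\<close> work over a subfield of the ambient (possibly non-commutative) ring;
  as \<open>(c \<odot> \<one>) \<otimes> x = c \<odot> x\<close>, spans and dimensions over this subfield are those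
  over the ground field itself.\<close>

definition scalars :: "('k, 'm) ring_scheme \<Rightarrow> ('k, 'a, 'n) module_scheme \<Rightarrow> 'a set"
  where "scalars K A = (\<lambda>c. c \<odot>\<^bsub>A\<^esub> \<one>\<^bsub>A\<^esub>) ` carrier K"

definition linear_span :: "('k, 'm) ring_scheme \<Rightarrow> ('k, 'a, 'n) module_scheme \<Rightarrow> 'a set \<Rightarrow> 'a set"
  where "linear_span K A S = (\<Union>us \<in> {us. set us \<subseteq> S}. ring.Span A (scalars K A) us)"

definition word_prod :: "('a, 'n) ring_scheme \<Rightarrow> 'a list \<Rightarrow> 'a"
  where "word_prod A w = foldr (\<otimes>\<^bsub>A\<^esub>) w \<one>\<^bsub>A\<^esub>"

definition generates_algebra ::
    "('k, 'm) ring_scheme \<Rightarrow> ('k, 'a, 'n) module_scheme \<Rightarrow> 'a set \<Rightarrow> bool"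
  where "generates_algebra K A S \<longleftrightarrow>
    S \<subseteq> carrier A \<and> generate_ring A (scalars K A \<union> S) = carrier A"

definition finitely_generated_algebra ::
    "('k, 'm) ring_scheme \<Rightarrow> ('k, 'a, 'n) module_scheme \<Rightarrow> bool"
  where "finitely_generated_algebra K A \<longleftrightarrow> (\<exists>S. finite S \<and> generates_algebra K A S)"

text \<open>Products of at most \<open>n\<close> factors; the empty product \<open>\<one>\<close> is included.\<close>

definition products_upto :: "('a, 'n) ring_scheme \<Rightarrow> 'a set \<Rightarrow> nat \<Rightarrow> 'a set"
  where "products_upto A S n = word_prod A ` {w. set w \<subseteq> S \<and> length w \<le> n}"

definition growth_function ::
    "('k, 'm) ring_scheme \<Rightarrow> ('k, 'a, 'n) module_scheme \<Rightarrow> 'a set \<Rightarrow> nat \<Rightarrow> nat"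
  where "growth_function K A S n =
    ring.dim A (scalars K A) (linear_span K A (products_upto A S n))"


section \<open>Polynomial identities\<close>

text \<open>A polynomial over \<open>K\<close> in non-commuting variables \<open>x\<^sub>0, x\<^sub>1, \<dots>\<close> is a finitely
  supported family of coefficients indexed by words in the variables, the word
  \<open>[i, j, \<dots>]\<close> standing for the monomial \<open>x\<^sub>i x\<^sub>j \<cdots>\<close>.\<close>

definition nc_polys :: "('k, 'm) ring_scheme \<Rightarrow> (nat list \<Rightarrow> 'k) set"
  where "nc_polys K = {p. (\<forall>w. p w \<in> carrier K) \<and> finite {w. p w \<noteq> \<zero>\<^bsub>K\<^esub>}}"

definition nc_eval ::
    "('k, 'm) ring_scheme \<Rightarrow> ('k, 'a, 'n) module_scheme \<Rightarrow> (nat list \<Rightarrow> 'k) \<Rightarrow> (nat \<Rightarrow> 'a) \<Rightarrow> 'a"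
  where "nc_eval K A p \<sigma> =
    (\<Oplus>\<^bsub>A\<^esub>w \<in> {w. p w \<noteq> \<zero>\<^bsub>K\<^esub>}. p w \<odot>\<^bsub>A\<^esub> word_prod A (map \<sigma> w))"

definition satisfies_polynomial_identity ::
    "('k, 'm) ring_scheme \<Rightarrow> ('k, 'a, 'n) module_scheme \<Rightarrow> bool"
  where "satisfies_polynomial_identity K A \<longleftrightarrow>
    (\<exists>p \<in> nc_polys K. (\<exists>w. p w \<noteq> \<zero>\<^bsub>K\<^esub>) \<and>
       (\<forall>\<sigma> \<in> UNIV \<rightarrow> carrier A. nc_eval K A p \<sigma> = \<zero>\<^bsub>A\<^esub>))"


section \<open>Carrier types\<close>

text \<open>An existence statement in HOL has to name the type of the elements. Algebras are
  sought with elements of type \<open>nat list \<Rightarrow> 'k\<close>. This is no restriction up to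
  isomorphism: in a finitely generated algebra, a suitable set of words in the
  generators is a basis, so each element is given by its finitely supported family
  of coefficients on words.\<close>

type_synonym 'k word_algebra = "('k, nat list \<Rightarrow> 'k) module"

end

theory Submission
  imports Defs
begin

text \<open>
  The algebra is a monomial algebra: the free algebra on \<open>x, y\<close> (the letters \<open>0, 1\<close>) modulo the words
  outside a factor-closed language \<open>L\<close>. Its growth is the number of words of \<open>L\<close> of length at most \<open>n\<close>,
  and if the words of \<open>L\<close> contain at most \<open>m\<close> letters \<open>y\<close>, then \<open>(x\<^sub>0 x\<^sub>1 - x\<^sub>1 x\<^sub>0)\<^bsup>m+1\<^esup>\<close> is an identity, because
  the algebra is commutative modulo the ideal generated by \<open>y\<close>.

  \<open>L\<close> consists of the factors of the words \<open>x\<^sup>N z x\<^sup>N\<close> with \<open>N = 2\<^sup>k\<close>, where \<open>z\<close> is \<open>y\<close> or one of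
  \<open>\<lfloor>(f(2N) - f(N)) / N\<^sup>2\<rfloor>\<close> words \<open>y x\<^bsup>b\<^sub>1\<^esup> y \<cdots> y x\<^bsup>b\<^sub>p\<^esup> y\<close> with all \<open>b\<^sub>i\<close> in \<open>[N, 2N)\<close>; as \<open>f\<close> is polynomially
  bounded, a fixed \<open>p\<close> provides enough of them. Since the letters \<open>y\<close> are far apart, the scale \<open>N\<close>
  contributes to the words of length at most \<open>N\<close> only words with at most one \<open>y\<close>, of which there are
  \<open>O(N\<^sup>2)\<close>. Each \<open>z\<close> contributes of the order of \<open>N\<^sup>2\<close> longer words, since a factor is determined by its two
  end points. Summing over the scales up to \<open>n\<close> telescopes to \<open>f\<close> up to a term \<open>O(n\<^sup>2)\<close>, which is
  dominated by \<open>f\<close>.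
\<close>

section \<open>Sparse binary words\<close>

text \<open>Quantifying over all pairs of ones instead of consecutive ones changes nothing, since
  further ones only lengthen the gap; in this form the property passes to factors at once.\<close>

definition spaced :: "nat \<Rightarrow> nat list \<Rightarrow> bool"
  where "spaced N w \<longleftrightarrow> (\<forall>u v t. w = u @ 1 # v @ 1 # t \<longrightarrow> N \<le> length v)"

lemma spaced_factor:
  assumes "spaced N (u @ w @ v)"
  shows "spaced N w"
  unfolding spaced_def
proof (intro allI impI)
  fix u' v' t' assume "w = u' @ 1 # v' @ 1 # t'"
  then have "u @ w @ v = (u @ u') @ 1 # v' @ 1 # (t' @ v)" by simp
  then show "N \<le> length v'" using assms unfolding spaced_def by blast
qed

lemma spaced_singleton: "spaced N [1]"
  unfolding spaced_def by (auto simp: Cons_eq_append_conv)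

lemma spaced_zeros_append: "spaced N w \<Longrightarrow> spaced N (replicate a 0 @ w)"
proof (induction a)
  case (Suc a)
  then have "spaced N (replicate a 0 @ w)" by simp
  then show ?case unfolding spaced_def by (auto simp: Cons_eq_append_conv)
qed simp

lemma spaced_append_zeros: "spaced N w \<Longrightarrow> spaced N (w @ replicate a 0)"
proof (induction a)
  case (Suc a)
  then have *: "spaced N (w @ replicate a 0)" by simp
  have eq: "w @ replicate (Suc a) 0 = (w @ replicate a 0) @ [0]"
    by (simp add: replicate_append_same)
  show ?case unfolding eq spaced_def
  proof (intro allI impI)
    fix u v t assume h: "(w @ replicate a 0) @ [0] = u @ 1 # v @ 1 # t"
    show "N \<le> length v"
    proof (cases t rule: rev_cases)
      case Nil
      then have "last ((w @ replicate a 0) @ [0::nat]) = 1" unfolding h by simp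
      then show ?thesis by simp
    next
      case (snoc t' x)
      then have "(w @ replicate a 0) @ [0] = (u @ 1 # v @ 1 # t') @ [x]" using h by simp
      then have "w @ replicate a 0 = u @ 1 # v @ 1 # t'" by blast
      then show ?thesis using * unfolding spaced_def by blast
    qed
  qed
qed simp

lemma spaced_one_zeros_append:
  assumes "spaced N z" and "N \<le> b"
  shows "spaced N (1 # replicate b 0 @ z)"
  unfolding spaced_def
proof (intro allI impI)
  fix u v t assume h: "1 # replicate b 0 @ z = u @ 1 # v @ 1 # t"
  show "N \<le> length v"
  proof (cases u)
    case Nil
    then have h': "replicate b 0 @ z = v @ 1 # t" using h by simp
    show ?thesis
    proof (rule ccontr)
      assume "\<not> N \<le> length v"
      then have "length v < b" using assms(2) by simp
      then have "(replicate b 0 @ z) ! length v = 0" by (simp add: nth_append)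
      then show False unfolding h' by simp
    qed
  next
    case (Cons c u')
    then have "replicate b 0 @ z = u' @ 1 # v @ 1 # t" using h by simp
    then show ?thesis using spaced_zeros_append[OF assms(1)] unfolding spaced_def by blast
  qed
qed

lemma binary_word_no_one:
  assumes "set w \<subseteq> {0, 1::nat}" and "1 \<notin> set w"
  shows "w = replicate (length w) 0"
  using assms by (intro replicate_length_same[symmetric]) auto

text \<open>Two ones with at least \<open>N\<close> letters between them need length
  \<open>N + 2\<close>, so at most one occurs here. There are only quadratically many such words,
  however many scales contribute them.\<close>

lemma spaced_short:
  assumes "spaced N w" and "length w \<le> N" and "set w \<subseteq> {0, 1}"
  shows "w \<in> (\<lambda>a. replicate a 0) ` {..length w} \<union>
              (\<lambda>(a, b). replicate a 0 @ 1 # replicate b 0) ` ({..length w} \<times> {..length w})"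
proof (cases "1 \<in> set w")
  case False
  then have "w = replicate (length w) 0" using assms(3) binary_word_no_one by blast
  then show ?thesis by blast
next
  case True
  then obtain u v where w: "w = u @ 1 # v" and u: "1 \<notin> set u"
    by (meson split_list_first)
  have v: "1 \<notin> set v"
  proof
    assume "1 \<in> set v"
    then obtain s t where "v = s @ 1 # t" by (meson split_list_first)
    then have "N \<le> length s" "length s < length w" using assms(1) w
      unfolding spaced_def by auto
    then show False using assms(2) by simp
  qed
  have "u = replicate (length u) 0" "v = replicate (length v) 0"
    using u v w assms(3) by (auto intro!: binary_word_no_one)
  then have "w = (\<lambda>(a, b). replicate a 0 @ 1 # replicate b 0) (length u, length v)"
    using w by simp
  moreover have "(length u, length v) \<in> {..length w} \<times> {..length w}" using w by simp
  ultimately show ?thesis by blast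
qed

section \<open>Words encoding lists of gaps\<close>

text \<open>The list consists of the lengths of the zero runs between consecutive ones. The final 1
  closes the last run, and the empty list encodes the word with the single letter 1.\<close>

definition blocks :: "nat list \<Rightarrow> nat list"
  where "blocks bs = concat (map (\<lambda>b. 1 # replicate b 0) bs) @ [1]"

lemma blocks_Nil [simp]: "blocks [] = [1]"
  and blocks_Cons [simp]: "blocks (b # bs) = 1 # replicate b 0 @ blocks bs"
  by (simp_all add: blocks_def)

lemma blocks_eq_Cons: "\<exists>v. blocks bs = 1 # v"
  by (cases bs) auto

lemma blocks_eq_snoc: "\<exists>v. blocks bs = v @ [1]"
  by (simp add: blocks_def)

text \<open>The first 1 marks the end of the initial zero run. This is the decoding step behind the
  injectivity statements for block words.\<close>

lemma zeros_append_one_eq_iff: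
  "replicate a (0::nat) @ 1 # v = replicate b 0 @ 1 # w \<longleftrightarrow> a = b \<and> v = w"
proof (induction a arbitrary: b)
  case 0 then show ?case by (cases b) auto
next
  case (Suc a) then show ?case by (cases b) auto
qed

lemma blocks_inj: "blocks bs = blocks cs \<Longrightarrow> bs = cs"
proof (induction bs arbitrary: cs)
  case Nil
  then show ?case by (cases cs) (auto simp: blocks_def)
next
  case (Cons b bs)
  show ?case
  proof (cases cs)
    case Nil
    then show ?thesis using Cons.prems by (auto simp: blocks_def)
  next
    case (Cons c cs')
    obtain v w where v: "blocks bs = 1 # v" and w: "blocks cs' = 1 # w"
      using blocks_eq_Cons by metis
    have "replicate b 0 @ 1 # v = replicate c 0 @ 1 # w"
      using Cons.prems Cons v w by simp
    then have "b = c" "v = w" unfolding zeros_append_one_eq_iff by auto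
    then show ?thesis using Cons.IH v w Cons by simp
  qed
qed

lemma spaced_blocks: "(\<And>b. b \<in> set bs \<Longrightarrow> N \<le> b) \<Longrightarrow> spaced N (blocks bs)"
proof (induction bs)
  case (Cons b bs)
  then show ?case unfolding blocks_Cons by (intro spaced_one_zeros_append) auto
qed (use spaced_singleton in simp)

lemma set_blocks: "set (blocks bs) \<subseteq> {0, 1}"
  by (induction bs) auto

lemma count_blocks: "count_list (blocks bs) 1 = length bs + 1"
proof (induction bs)
  case (Cons b bs)
  have "count_list (replicate b 0) (1::nat) = 0" by (induction b) auto
  then show ?case using Cons by simp
qed simp

text \<open>A block has \<open>b + 1\<close> \<le> \<open>N\<close> letters, whence the strict bound
  on the gaps; the summand 1 is the final letter.\<close>

lemma length_blocks: "(\<And>b. b \<in> set bs \<Longrightarrow> b < N) \<Longrightarrow> length (blocks bs) \<le> N * length bs + 1"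
proof (induction bs)
  case (Cons b bs)
  then have "length (blocks bs) \<le> N * length bs + 1" "b < N" by auto
  then show ?case by simp
qed simp

definition pad :: "nat \<Rightarrow> nat \<Rightarrow> nat list \<Rightarrow> nat list"
  where "pad a c z = replicate a 0 @ z @ replicate c 0"

text \<open>A block word starts and ends with 1, so the padding is visible from both ends:
  \<open>a\<close> is read off from the left, and \<open>c\<close> from the reversed word.\<close>

lemma pad_blocks_inj:
  assumes "pad a c (blocks bs) = pad a' c' (blocks bs')"
  shows "a = a' \<and> c = c' \<and> bs = bs'"
proof -
  obtain v v' where v: "blocks bs = 1 # v" and v': "blocks bs' = 1 # v'"
    using blocks_eq_Cons by metis
  have "replicate a 0 @ 1 # (v @ replicate c 0) = replicate a' 0 @ 1 # (v' @ replicate c' 0)"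
    using assms unfolding pad_def v v' by simp
  then have a: "a = a'" and e: "blocks bs @ replicate c 0 = blocks bs' @ replicate c' 0"
    unfolding zeros_append_one_eq_iff v v' by auto
  obtain u u' where u: "blocks bs = u @ [1]" and u': "blocks bs' = u' @ [1]"
    using blocks_eq_snoc by metis
  have "rev (u @ 1 # replicate c 0) = rev (u' @ 1 # replicate c' 0)"
    using e u u' by simp
  then have "replicate c 0 @ 1 # rev u = replicate c' 0 @ 1 # rev u'" by simp
  then have "c = c'" "u = u'" unfolding zeros_append_one_eq_iff by auto
  then show ?thesis using a u u' blocks_inj by metis
qed

section \<open>Counting factors of a word\<close>

definition factors :: "nat list \<Rightarrow> nat list set"
  where "factors w = {v. \<exists>u t. w = u @ v @ t}"

text \<open>A factor is determined by its starting position and its length, which makes the count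
  quadratic.\<close>

lemma factors_subset_image:
  "factors w \<subseteq> (\<lambda>(i, j). take j (drop i w)) ` ({..length w} \<times> {..length w})"
proof
  fix v assume "v \<in> factors w"
  then obtain u t where w: "w = u @ v @ t" unfolding factors_def by blast
  then have "v = (\<lambda>(i, j). take j (drop i w)) (length u, length v)" by simp
  moreover have "(length u, length v) \<in> {..length w} \<times> {..length w}" using w by simp
  ultimately show "v \<in> (\<lambda>(i, j). take j (drop i w)) ` ({..length w} \<times> {..length w})" by blast
qed

lemma finite_factors: "finite (factors w)"
  using factors_subset_image finite_subset by blast

lemma card_factors_le: "card (factors w) \<le> (length w + 1)^2"
proof -
  have "card (factors w) \<le> card ((\<lambda>(i, j). take j (drop i w)) ` ({..length w} \<times> {..length w}))"
    using factors_subset_image by (intro card_mono) auto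
  also have "\<dots> \<le> card ({..length w} \<times> {..length w})" by (rule card_image_le) simp
  finally show ?thesis by (simp add: card_cartesian_product power2_eq_square)
qed

section \<open>Dyadic estimates and absorption of quadratic terms\<close>

lemma power4_eq: "(4::nat)^k = (2^k)^2"
  by (simp add: power2_eq_square flip: power_mult_distrib)

lemma sum_powers4_le: "(\<Sum>k=1..K. 4^k) \<le> (2 * 4^K :: nat)"
  by (induction K) auto

text \<open>The quadratic term is absorbed by \<open>f\<close> through \<open>sq\<close>, and
  monotonicity of \<open>f\<close> lets the dilations \<open>D\<close> and \<open>D'\<close> be
  replaced by the common one \<open>D * D'\<close>.\<close>

lemma growth_leI:
  assumes mono: "strict_mono_on {1..} f"
    and sq: "(\<lambda>n. n^2) \<preceq>\<^sub>g f"
    and D: "D \<ge> 1"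
    and le: "\<And>n. n \<ge> 1 \<Longrightarrow> g n \<le> A * n^2 + B * f (D * n)"
  shows "g \<preceq>\<^sub>g f"
proof -
  obtain C D' where C: "C > 0" and D': "D' > 0"
    and s: "\<And>n. n \<ge> 1 \<Longrightarrow> real (n^2) \<le> C * real (f (D' * n))"
    using sq unfolding growth_le_def by auto
  have m: "f a \<le> f b" if "1 \<le> a" "a \<le> b" for a b
    using strict_mono_on_leD[OF mono] that by auto
  \<comment> \<open>The extra 1 keeps the constant positive when \<open>A\<close> and
    \<open>B\<close> are both 0.\<close>
  have "real (g n) \<le> (A * C + B + 1) * real (f ((D * D') * n))" if n: "n \<ge> 1" for n
  proof -
    have 1: "f (D' * n) \<le> f (D * D' * n)" "f (D * n) \<le> f (D * D' * n)"
      using n D D' by (auto intro!: m)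
    have "real (g n) \<le> real A * real (n^2) + real B * real (f (D * n))"
      using le[OF n] by (metis of_nat_add of_nat_le_iff of_nat_mult)
    also have "\<dots> \<le> real A * (C * real (f (D * D' * n))) + real B * real (f (D * D' * n))"
    proof (intro add_mono mult_left_mono)
      have "real (n^2) \<le> C * real (f (D' * n))" using s n by simp
      also have "\<dots> \<le> C * real (f (D * D' * n))" using 1 C by simp
      finally show "real (n^2) \<le> C * real (f (D * D' * n))" .
    qed (use 1 in auto)
    also have "\<dots> \<le> (A * C + B + 1) * real (f (D * D' * n))"
      by (simp add: algebra_simps)
    finally show ?thesis .
  qed
  moreover have "A * C + B + 1 > 0" using C by (simp add: add_nonneg_pos)
  moreover have "D * D' > 0" using D D' by simp
  ultimately show ?thesis unfolding growth_le_def by blast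
qed

lemma dyadic_bounds:
  assumes "n \<ge> (1::nat)"
  obtains K where "2^K \<le> n" "n < 2^(K + 1)"
  using ex_power_ivl1[of 2 n] assms by auto

text \<open>The exponent will be the number of gaps, so that there are enough lists of gaps at every
  scale. For \<open>k\<close> \<ge> 1 the constant factor and the passage from \<open>k + 1\<close>
  to \<open>k\<close> disappear into the exponent; at \<open>k = 0\<close> the right-hand side would
  be 1.\<close>

lemma dyadic_polynomial_bound:
  assumes "polynomially_bounded f"
  obtains p where "\<And>k. k \<ge> 1 \<Longrightarrow> f (2^(k+1)) \<le> (2^k)^p"
proof -
  obtain C d :: real where C: "C > 0" and d: "d > 0"
    and le: "\<And>n. n \<ge> 1 \<Longrightarrow> real (f n) \<le> C * real n powr d"
    using assms unfolding polynomially_bounded_def by auto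
  define e where "e = nat \<lceil>d\<rceil>"
  obtain m where m: "C < 2^m" using real_arch_pow[of 2 C] by auto
  show ?thesis
  proof
    fix k :: nat assume k: "k \<ge> 1"
    have "real (f (2^(k+1))) \<le> C * real (2^(k+1)) powr d" by (rule le) simp
    also have "\<dots> \<le> C * real (2^(k+1)) powr real e"
    proof -
      have "d \<le> real e" unfolding e_def by linarith
      moreover have "(1::real) \<le> 2^(k+1)" by (rule one_le_power) simp
      ultimately show ?thesis using C by (auto intro!: powr_mono)
    qed
    also have "\<dots> = C * real ((2^(k+1))^e)" by (simp add: powr_realpow)
    also have "\<dots> \<le> 2^m * real ((2^(k+1))^e)" using m by (intro mult_right_mono) auto
    also have "\<dots> = real (2^(m + (k+1)*e))" by (simp add: power_add power_mult)
    finally have "f (2^(k+1)) \<le> 2^(m + (k+1)*e)" by linarith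
    also have "\<dots> \<le> (2^k)^(m + 2*e)"
    proof -
      have "m \<le> k * m" "e \<le> k * e" using k by auto
      then have "m + (k * e + e) \<le> k * m + (k * e + k * e)" by linarith
      then have "m + (k+1)*e \<le> k * (m + 2*e)" by (simp only: algebra_simps mult_2)
      then show ?thesis unfolding power_mult[symmetric] by (intro power_increasing) auto
    qed
    finally show "f (2^(k+1)) \<le> (2^k)^(m + 2*e)" .
  qed
qed

text \<open>The combinatorial half of the proof. Closure under factors will make the words outside
  \<open>L\<close> span an ideal, the bound \<open>m\<close> on the number of ones will produce the
  identity, and the last property will be the growth of the algebra.\<close>

lemma language_with_growth:
  fixes f :: "nat \<Rightarrow> nat"
  assumes mono: "strict_mono_on {1..} f"
    and poly: "polynomially_bounded f"
    and sq: "(\<lambda>n. n^2) \<preceq>\<^sub>g f"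
  obtains L :: "nat list set" and m where "L \<subseteq> lists {0, 1}"
    and "\<And>u w v. u @ w @ v \<in> L \<Longrightarrow> w \<in> L"
    and "[0] \<in> L" and "[1] \<in> L"
    and "\<And>w. w \<in> L \<Longrightarrow> count_list w 1 \<le> m"
    and "(\<lambda>n. card {w \<in> L. length w \<le> n}) \<sim>\<^sub>g f"
proof -

  \<comment> \<open>Choice of the words at each scale\<close>
  have m: "f a \<le> f b" if "1 \<le> a" "a \<le> b" for a b
    using strict_mono_on_leD[OF mono] that by auto
  obtain p' where p': "\<And>k. k \<ge> 1 \<Longrightarrow> f (2^(k+1)) \<le> (2^k)^p'"
    using dyadic_polynomial_bound[OF poly] by blast
  \<comment> \<open>The successor makes \<open>p\<close> positive, so no list in \<open>P k\<close>
    is empty and each one reveals its scale through its entries.\<close>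
  define p where "p = Suc p'"
  have p: "f (2^(k+1)) \<le> (2^k)^p" if "k \<ge> 1" for k
    using p'[OF that] power_increasing[of p' p "2^k :: nat"] unfolding p_def by (simp del: power_Suc)
  \<comment> \<open>The increment of \<open>f\<close> at scale \<open>2^k\<close> is to be realised
    by \<open>s k\<close> words with about \<open>4^k\<close> factors each; rounding down loses less
    than \<open>4^k\<close>.\<close>
  define \<delta> where "\<delta> k = f (2^(k+1)) - f (2^k)" for k
  define s where "s k = \<delta> k div 4^k" for k
  define P where "P k = {bs. set bs \<subseteq> {2^k..<2^(k+1)::nat} \<and> length bs = p}" for k
  have cardP: "card (P k) = (2^k)^p" for k
    unfolding P_def by (subst card_lists_length_eq) auto
  have "\<exists>T\<subseteq>P k. card T = s k" if k: "k \<ge> 1" for k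
  proof -
    have "s k \<le> \<delta> k" unfolding s_def by simp
    also have "\<dots> \<le> f (2^(k+1))" unfolding \<delta>_def by simp
    finally have "s k \<le> card (P k)" using p[OF k] cardP by simp
    then show ?thesis by (metis obtain_subset_with_card_n)
  qed
  then obtain T where T: "\<And>k. k \<ge> 1 \<Longrightarrow> T k \<subseteq> P k" "\<And>k. k \<ge> 1 \<Longrightarrow> card (T k) = s k"
    by metis
  have finP: "finite (P k)" for k unfolding P_def by (rule finite_lists_length_eq) simp
  have finT: "finite (T k)" if "k \<ge> 1" for k using T(1)[OF that] finP finite_subset by blast
  define U where "U k = insert [] (T k)" for k
  define L where "L = (\<Union>k\<in>{1..}. \<Union>bs\<in>U k. factors (pad (2^k) (2^k) (blocks bs)))"
  \<comment> \<open>With at most \<open>p\<close> gaps, all below \<open>2^(k+1)\<close>, and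
    padding \<open>2^k\<close> on both sides, a word at scale \<open>k\<close> has length at most
    \<open>2^(k+1) * p + 2 * 2^k + 1\<close>, which is less than \<open>q * 2^k\<close>.\<close>
  define q where "q = 2 * (p + 2)"
  have Ub: "set bs \<subseteq> {2^k..<2^(k+1)}" "length bs \<le> p" if "k \<ge> 1" "bs \<in> U k" for k bs
    using that T(1)[of k] unfolding U_def P_def by auto

  \<comment> \<open>Alphabet, factors and number of ones\<close>
  have Lbin: "L \<subseteq> lists {0, 1}"
  proof
    fix w assume "w \<in> L"
    then obtain k bs u v where "pad (2^k) (2^k) (blocks bs) = u @ w @ v"
      unfolding L_def factors_def by blast
    then have "set w \<subseteq> set (pad (2^k) (2^k) (blocks bs))" by auto
    also have "\<dots> \<subseteq> {0, 1}" using set_blocks unfolding pad_def by auto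
    finally show "w \<in> lists {0, 1}" by auto
  qed
  have Lfac: "w \<in> L" if uwv: "u @ w @ v \<in> L" for u w v
  proof -
    obtain k bs u' v' where k: "k \<in> {1..}" "bs \<in> U k"
      and "pad (2^k) (2^k) (blocks bs) = u' @ (u @ w @ v) @ v'"
      using uwv unfolding L_def factors_def by blast
    then have "pad (2^k) (2^k) (blocks bs) = (u' @ u) @ w @ (v @ v')" by simp
    then show ?thesis using k unfolding L_def factors_def by blast
  qed
  have Lpad: "pad a c (blocks bs) \<in> L" if "k \<ge> 1" "bs \<in> U k" "a \<le> 2^k" "c \<le> 2^k" for a c k bs
  proof -
    have "replicate (2^k) 0 = replicate (2^k - a) (0::nat) @ replicate a 0"
      "replicate (2^k) 0 = replicate c (0::nat) @ replicate (2^k - c) 0"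
      using that by (auto simp flip: replicate_add)
    then have "pad (2^k) (2^k) (blocks bs)
        = replicate (2^k - a) 0 @ pad a c (blocks bs) @ replicate (2^k - c) 0"
      unfolding pad_def by (metis append.assoc)
    then show ?thesis using that unfolding L_def factors_def by fastforce
  qed
  have Lone: "pad a c [1] \<in> L" for a c
  proof -
    \<comment> \<open>Around a single 1 the padding can be arbitrarily long, since a large enough
      scale is always available.\<close>
    have "a + c + 1 < 2^(a + c + 1)" by (rule less_exp)
    then have "pad a c (blocks []) \<in> L"
      by (intro Lpad[of "a + c + 1"]) (auto simp: U_def)
    then show ?thesis by simp
  qed
  have L1: "[1] \<in> L" using Lone[of 0 0] by (simp add: pad_def)
  have L0: "[0] \<in> L" using Lone[of 1 0] Lfac[of "[]" "[0]" "[1]"] by (simp add: pad_def)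
  have Lcount: "count_list w 1 \<le> p + 1" if wL: "w \<in> L" for w
  proof -
    obtain k bs u v where k: "k \<ge> 1" "bs \<in> U k"
      and e: "pad (2^k) (2^k) (blocks bs) = u @ w @ v"
      using wL unfolding L_def factors_def by auto
    have z: "count_list (replicate j 0) (1::nat) = 0" for j by (induction j) auto
    have "count_list w 1 \<le> count_list (u @ w @ v) 1" by simp
    also have "\<dots> = length bs + 1" unfolding e[symmetric] pad_def by (simp add: z count_blocks del: One_nat_def)
    also have "\<dots> \<le> p + 1" using Ub(2)[OF k] by simp
    finally show ?thesis .
  qed

  \<comment> \<open>Auxiliary counts\<close>
  define g where "g n = card {w \<in> L. length w \<le> n}" for n
  have finL: "finite {w \<in> L. length w \<le> n}" for n
  proof (rule finite_subset)
    show "{w \<in> L. length w \<le> n} \<subseteq> {w. set w \<subseteq> {0, 1} \<and> length w \<le> n}" using Lbin by auto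
  qed (rule finite_lists_length_le, simp)
  have cardF: "card (factors (pad (2^k) (2^k) (blocks bs))) \<le> q^2 * 4^k"
    if "k \<ge> 1" "bs \<in> U k" for k bs
  proof -
    have "length (blocks bs) \<le> 2^(k+1) * length bs + 1"
      using Ub(1)[OF that] by (intro length_blocks) auto
    also have "\<dots> \<le> 2^(k+1) * p + 1" using Ub(2)[OF that] by simp
    finally have "length (pad (2^k) (2^k) (blocks bs)) + 1 \<le> 2^(k+1) * p + 2 * 2^k + 2"
      unfolding pad_def by simp
    also have "\<dots> \<le> q * 2^k" unfolding q_def by (simp add: algebra_simps)
    finally have "(length (pad (2^k) (2^k) (blocks bs)) + 1)^2 \<le> (q * 2^k)^2"
      by (rule power_mono) simp
    also have "\<dots> = q^2 * 4^k" by (simp only: power_mult_distrib power4_eq)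
    finally show ?thesis using card_factors_le le_trans by blast
  qed
  \<comment> \<open>Monotonicity of \<open>f\<close> makes the truncated subtraction in
    \<open>\<delta>\<close> exact; the sum starts at scale 1, which leaves the term
    \<open>f 2\<close>.\<close>
  have telescope: "(\<Sum>k=1..K. \<delta> k) + f 2 = f (2^(K+1))" for K
  proof (induction K)
    case (Suc K)
    have "f (2^(K+1)) \<le> f (2^(K+2))" by (rule m) auto
    then show ?case using Suc unfolding \<delta>_def by simp
  qed simp

  \<comment> \<open>Upper bound for the number of words\<close>
  have upper: "g n \<le> (6 + 2 * q^2) * n^2 + q^2 * f (2 * n)" if n: "n \<ge> 1" for n
  proof -
    obtain K where K: "2^K \<le> n" "n < 2^(K+1)" using dyadic_bounds[OF n] by blast
    let ?A = "(\<lambda>a. replicate a (0::nat)) ` {..n}"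
    let ?B = "(\<lambda>(a, b). replicate a (0::nat) @ 1 # replicate b 0) ` ({..n} \<times> {..n})"
    let ?F = "\<Union>k\<in>{1..K}. \<Union>bs\<in>U k. factors (pad (2^k) (2^k) (blocks bs))"
    \<comment> \<open>Scales up to \<open>K\<close> are counted with all their factors in
      \<open>?F\<close>; larger scales contribute only the quadratically many words with at most one
      1.\<close>
    have sub: "{w \<in> L. length w \<le> n} \<subseteq> (?A \<union> ?B) \<union> ?F"
    proof
      fix w assume "w \<in> {w \<in> L. length w \<le> n}"
      then have w: "w \<in> L" "length w \<le> n" by auto
      then obtain k bs where k: "k \<ge> 1" "bs \<in> U k"
        and wf: "w \<in> factors (pad (2^k) (2^k) (blocks bs))"
        unfolding L_def by auto
      show "w \<in> (?A \<union> ?B) \<union> ?F"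
      proof (cases "k \<le> K")
        case True
        then show ?thesis using k wf by auto
      next
        case False
        \<comment> \<open>Here \<open>n < 2^(K+1)\<close> \<le> \<open>2^k\<close>, so
          \<open>w\<close> is no longer than the minimal gap of its scale.\<close>
        then have "(2::nat)^(K+1) \<le> 2^k" by (intro power_increasing) auto
        then have len: "length w \<le> 2^k" using K w by simp
        have "spaced (2^k) (pad (2^k) (2^k) (blocks bs))" unfolding pad_def
          using Ub(1)[OF k] by (intro spaced_zeros_append spaced_append_zeros spaced_blocks) auto
        then have "spaced (2^k) w" using wf spaced_factor unfolding factors_def by auto
        moreover have "set w \<subseteq> {0, 1}" using w Lbin by auto
        ultimately have "w \<in> (\<lambda>a. replicate a 0) ` {..length w} \<union>
              (\<lambda>(a, b). replicate a 0 @ 1 # replicate b 0) ` ({..length w} \<times> {..length w})"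
          using len by (intro spaced_short)
        also have "\<dots> \<subseteq> ?A \<union> ?B" using w(2) by (intro Un_mono image_mono) auto
        finally show ?thesis by blast
      qed
    qed
    have cF: "card ?F \<le> q^2 * f (2 * n) + 2 * q^2 * n^2"
    proof -
      have "card ?F \<le> (\<Sum>k=1..K. card (\<Union>bs\<in>U k. factors (pad (2^k) (2^k) (blocks bs))))"
        by (rule card_UN_le) simp
      \<comment> \<open>Up to the factor \<open>q^2\<close>, the chosen words account for
        \<open>s k * 4^k\<close> \<le> \<open>\<delta> k\<close>, and the empty list accounts for
        the extra \<open>4^k\<close>.\<close>
      also have "\<dots> \<le> (\<Sum>k=1..K. q^2 * (\<delta> k + 4^k))"
      proof (rule sum_mono)
        fix k assume "k \<in> {1..K}"
        then have k: "k \<ge> 1" by simp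
        have "card (\<Union>bs\<in>U k. factors (pad (2^k) (2^k) (blocks bs)))
            \<le> (\<Sum>bs\<in>U k. card (factors (pad (2^k) (2^k) (blocks bs))))"
          by (rule card_UN_le) (simp add: U_def finT[OF k])
        also have "\<dots> \<le> (\<Sum>bs\<in>U k. q^2 * 4^k)" using cardF[OF k] by (rule sum_mono)
        also have "\<dots> = card (U k) * (q^2 * 4^k)" by simp
        also have "\<dots> \<le> (s k + 1) * (q^2 * 4^k)"
          using T(2)[OF k] finT[OF k] unfolding U_def by (intro mult_right_mono) (auto simp: card_insert_if)
        also have "\<dots> = q^2 * (s k * 4^k + 4^k)" by (simp add: algebra_simps)
        also have "\<dots> \<le> q^2 * (\<delta> k + 4^k)" unfolding s_def by simp
        finally show "card (\<Union>bs\<in>U k. factors (pad (2^k) (2^k) (blocks bs))) \<le> q^2 * (\<delta> k + 4^k)" .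
      qed
      also have "\<dots> = q^2 * ((\<Sum>k=1..K. \<delta> k) + (\<Sum>k=1..K. 4^k))"
        by (simp add: sum_distrib_left sum.distrib distrib_left)
      also have "\<dots> \<le> q^2 * (f (2 * n) + 2 * n^2)"
      proof (intro mult_left_mono add_mono)
        \<comment> \<open>Since \<open>2^K\<close> \<le> \<open>n\<close>, the telescoped sum is
          bounded by \<open>f (2 * n)\<close>; this is the source of the dilation by 2.\<close>
        have "f (2^(K+1)) \<le> f (2 * n)" using K by (intro m) auto
        then show "(\<Sum>k=1..K. \<delta> k) \<le> f (2 * n)" using telescope[of K] by simp
        have "(4::nat)^K = (2^K)^2" by (rule power4_eq)
        also have "\<dots> \<le> n^2" using K by (intro power_mono) auto
        finally show "(\<Sum>k=1..K. 4^k) \<le> 2 * n^2" using sum_powers4_le[of K] by linarith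
      qed auto
      finally show ?thesis by (simp add: algebra_simps)
    qed
    have "card ?A \<le> n + 1" using card_image_le[of "{..n}"] by simp
    moreover have "card ?B \<le> (n + 1)^2"
      using card_image_le[of "{..n} \<times> {..n}" "\<lambda>(a, b). replicate a (0::nat) @ 1 # replicate b 0"]
      by (simp add: card_cartesian_product power2_eq_square)
    moreover have "card ((?A \<union> ?B) \<union> ?F) \<le> card ?A + card ?B + card ?F"
      by (meson add_right_mono card_Un_le le_trans)
    moreover have "g n \<le> card ((?A \<union> ?B) \<union> ?F)" unfolding g_def
      by (rule card_mono[OF _ sub]) (auto simp: U_def finT finite_factors)
    ultimately have "g n \<le> (n + 1) + (n + 1)^2 + card ?F" by linarith
    \<comment> \<open>Equality at \<open>n = 1\<close> dictates the constant 6.\<close>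
    moreover have "(n + 1) + (n + 1)^2 \<le> 6 * n^2"
    proof -
      obtain j where "n = Suc j" using n by (cases n) auto
      then show ?thesis by (simp add: power2_eq_square algebra_simps)
    qed
    ultimately show ?thesis using cF by (simp add: algebra_simps)
  qed

  \<comment> \<open>Lower bound for the number of words\<close>
  have lower: "f n \<le> (f 2 + 3) * g (q * n)" if n: "n \<ge> 1" for n
  proof -
    obtain K where K: "2^K \<le> n" "n < 2^(K+1)" using dyadic_bounds[OF n] by blast
    \<comment> \<open>The words with one 1 and fewer than \<open>n\<close> zeros on each side
      already number \<open>n^2\<close>.\<close>
    have sq_le: "n^2 \<le> g (q * n)"
    proof -
      let ?h = "\<lambda>(a, c). pad a c (blocks [])"
      have "n^2 = card ({..<n} \<times> {..<n})"
        by (simp add: card_cartesian_product power2_eq_square)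
      also have "\<dots> = card (?h ` ({..<n} \<times> {..<n}))"
        using pad_blocks_inj by (intro card_image[symmetric] inj_onI) (auto simp del: blocks_Nil)
      also have "\<dots> \<le> g (q * n)" unfolding g_def
      proof (intro card_mono[OF finL] image_subsetI)
        fix x assume "x \<in> {..<n} \<times> {..<n}"
        then obtain a c where x: "x = (a, c)" and "a < n" "c < n" by auto
        then have "length (pad a c (blocks [])) \<le> 4 * n" by (simp add: pad_def)
        also have "\<dots> \<le> q * n" unfolding q_def by simp
        finally show "?h x \<in> {w \<in> L. length w \<le> q * n}"
          using Lone x by simp
      qed
      finally show ?thesis .
    qed
    \<comment> \<open>Every \<open>bs\<close> in \<open>T k\<close> gives \<open>4^k\<close>
      different words, one for each choice of the two paddings below \<open>2^k\<close>.\<close>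
    have T_le: "(\<Sum>k=1..K. 4^k * s k) \<le> g (q * n)"
    proof -
      define Y where "Y k = T k \<times> ({..<2^k::nat} \<times> {..<2^k::nat})" for k
      let ?h = "\<lambda>(bs, a, c). pad a c (blocks bs)"
      have YT: "bs \<in> T k" if "(bs, a, c) \<in> Y k" for bs a c k using that by (simp add: Y_def)
      have inj: "inj_on (\<lambda>(k, x). ?h x) (SIGMA k:{1..K}. Y k)"
      proof (rule inj_onI, clarify)
        fix k bs a c k' bs' a' c'
        assume k: "k \<in> {1..K}" "k' \<in> {1..K}" and x: "(bs, a, c) \<in> Y k" "(bs', a', c') \<in> Y k'"
          and e: "pad a c (blocks bs) = pad a' c' (blocks bs')"
        have eq: "a = a'" "c = c'" "bs = bs'" using pad_blocks_inj[OF e] by auto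
        have bP: "bs \<in> P k" "bs \<in> P k'" using T(1) YT x k eq by fastforce+
        \<comment> \<open>Any gap determines the scale, because the intervals
          \<open>[2^k, 2^(k+1))\<close> are disjoint; a gap exists because \<open>p\<close> is
          positive.\<close>
        have "bs \<noteq> []" using bP unfolding P_def p_def by auto
        then obtain b where "b \<in> set bs" by (cases bs) auto
        then have b: "2^k \<le> b" "b < 2^(k+1)" "2^k' \<le> b" "b < 2^(k'+1)"
          using bP unfolding P_def by auto
        have "(2::nat)^k < 2^(k'+1)" "(2::nat)^k' < 2^(k+1)" using b by linarith+
        then have "k < k' + 1" "k' < k + 1" by (simp_all only: power_strict_increasing_iff one_less_numeral_iff semiring_norm)
        then have "k = k'" by simp
        then show "k = k' \<and> (bs, a, c) = (bs', a', c')" using eq by simp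
      qed
      have sub: "(\<lambda>(k, x). ?h x) ` (SIGMA k:{1..K}. Y k) \<subseteq> {w \<in> L. length w \<le> q * n}"
      proof clarify
        fix k bs a c assume k: "k \<in> {1..K}" and x: "(bs, a, c) \<in> Y k"
        then have k1: "k \<ge> 1" and bU: "bs \<in> U k" and ac: "a < 2^k" "c < 2^k"
          by (auto simp: Y_def U_def)
        have "length (blocks bs) \<le> 2^(k+1) * length bs + 1"
          using Ub(1)[OF k1 bU] by (intro length_blocks) auto
        also have "\<dots> \<le> 2^(k+1) * p + 1" using Ub(2)[OF k1 bU] by simp
        finally have "length (pad a c (blocks bs)) \<le> 2^(k+1) * p + 2 * 2^k + 1"
          using ac unfolding pad_def by simp
        also have "\<dots> \<le> q * 2^k" unfolding q_def by (simp add: algebra_simps)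
        also have "\<dots> \<le> q * 2^K" using k by simp
        also have "\<dots> \<le> q * n" using K by simp
        finally show "pad a c (blocks bs) \<in> L \<and> length (pad a c (blocks bs)) \<le> q * n"
          using Lpad[OF k1 bU] ac by simp
      qed
      have "(\<Sum>k=1..K. 4^k * s k) = (\<Sum>k=1..K. card (Y k))"
      proof (rule sum.cong[OF refl])
        fix k assume "k \<in> {1..K}"
        moreover have "(4::nat)^k = 2^k * 2^k" by (simp flip: power_mult_distrib)
        ultimately show "4^k * s k = card (Y k)"
          using T(2)[of k] by (simp add: Y_def card_cartesian_product)
      qed
      also have "\<dots> = card (SIGMA k:{1..K}. Y k)"
        by (subst card_SigmaI) (auto simp: Y_def finT)
      also have "\<dots> = card ((\<lambda>(k, x). ?h x) ` (SIGMA k:{1..K}. Y k))"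
        by (rule card_image[OF inj, symmetric])
      also have "\<dots> \<le> g (q * n)" unfolding g_def by (rule card_mono[OF finL sub])
      finally show ?thesis .
    qed
    have "f n \<le> f (2^(K+1))" using K n by (intro m) auto
    also have "\<dots> = (\<Sum>k=1..K. \<delta> k) + f 2" by (rule telescope[symmetric])
    \<comment> \<open>Rounding lost less than \<open>4^k\<close> at each scale, in total at most
      \<open>2 * 4^K\<close> \<le> \<open>2 * n^2\<close>.\<close>
    also have "\<dots> \<le> (\<Sum>k=1..K. 4^k * s k + 4^k) + f 2"
    proof (intro add_mono sum_mono order_refl)
      fix k
      have "\<delta> k = 4^k * s k + \<delta> k mod 4^k" unfolding s_def by simp
      moreover have "\<delta> k mod 4^k < 4^k" by simp
      ultimately show "\<delta> k \<le> 4^k * s k + 4^k" by linarith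
    qed
    also have "\<dots> = (\<Sum>k=1..K. 4^k * s k) + (\<Sum>k=1..K. 4^k) + f 2"
      by (simp add: sum.distrib)
    also have "\<dots> \<le> g (q * n) + 2 * g (q * n) + f 2 * g (q * n)"
    proof (intro add_mono T_le)
      have "(4::nat)^K = (2^K)^2" by (rule power4_eq)
      also have "\<dots> \<le> n^2" using K by (intro power_mono) auto
      finally show "(\<Sum>k=1..K. 4^k) \<le> 2 * g (q * n)" using sum_powers4_le[of K] sq_le by linarith
      \<comment> \<open>The constant \<open>f 2\<close> left over by the telescoping is absorbed by
        the factor \<open>g (q * n)\<close>, which is at least 1.\<close>
      have "1 \<le> n^2" using n by simp
      then have "1 \<le> g (q * n)" using sq_le by linarith
      then show "f 2 \<le> f 2 * g (q * n)" by simp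
    qed
    finally show ?thesis by (simp add: algebra_simps)
  qed
  have "g \<preceq>\<^sub>g f" using upper by (intro growth_leI[OF mono sq, of 2]) auto
  moreover have "f \<preceq>\<^sub>g g" unfolding growth_le_def
  proof (intro exI conjI allI impI)
    show "real (f n) \<le> real (f 2 + 3) * real (g (q * n))" if "1 \<le> n" for n
      using lower[OF that] by (metis of_nat_le_iff of_nat_mult)
    show "real (f 2 + 3) > 0" by simp
    show "q > 0" unfolding q_def by simp
  qed
  ultimately have "(\<lambda>n. card {w \<in> L. length w \<le> n}) \<sim>\<^sub>g f"
    unfolding growth_equiv_def g_def by simp
  from that[OF Lbin Lfac L0 L1 Lcount this] show ?thesis .
qed

section \<open>Growth and generating sets\<close>

lemma growth_le_trans:
  assumes "f \<preceq>\<^sub>g g" and "g \<preceq>\<^sub>g h"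
  shows "f \<preceq>\<^sub>g h"
proof -
  obtain C D where C: "C > 0" "D > 0" "\<And>n. n \<ge> 1 \<Longrightarrow> real (f n) \<le> C * real (g (D * n))"
    using assms(1) unfolding growth_le_def by blast
  obtain C' D' where C': "C' > 0" "D' > 0" "\<And>n. n \<ge> 1 \<Longrightarrow> real (g n) \<le> C' * real (h (D' * n))"
    using assms(2) unfolding growth_le_def by blast
  have "real (f n) \<le> C * C' * real (h (D' * D * n))" if n: "n \<ge> 1" for n
  proof -
    have "real (f n) \<le> C * real (g (D * n))" using C n by blast
    also have "\<dots> \<le> C * (C' * real (h (D' * (D * n))))"
      using C C' n by (intro mult_left_mono C'(3)) auto
    finally show ?thesis by (simp add: mult.assoc)
  qed
  moreover have "C * C' > 0" "D' * D > 0" using C C' by auto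
  ultimately show ?thesis unfolding growth_le_def by blast
qed

section \<open>Subspaces and dimension over the ground field\<close>

locale field_algebra = K: field K + A: ring A
  for K :: "('k, 'm) ring_scheme" and A :: "('k, 'a, 'n) module_scheme" +
  assumes assoc_algebra: "assoc_algebra K A"
    and nontrivial: "\<one>\<^bsub>A\<^esub> \<noteq> \<zero>\<^bsub>A\<^esub>"
begin

lemma module: "module K A"
  using assoc_algebra by (rule assoc_algebra.axioms)

lemmas smult_closed = module.smult_closed[OF module]
  and smult_l_distr = module.smult_l_distr[OF module]
  and smult_assoc1 = module.smult_assoc1[OF module]
  and smult_one = module.smult_one[OF module]
  and smult_l_minus = module.smult_l_minus[OF module]
  and smult_r_minus = module.smult_r_minus[OF module]
  and smult_mult_left = assoc_algebra.smult_mult_left[OF assoc_algebra]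
  and smult_mult_right = assoc_algebra.smult_mult_right[OF assoc_algebra]

lemma scalar_mult:
  "c \<in> carrier K \<Longrightarrow> x \<in> carrier A \<Longrightarrow> (c \<odot>\<^bsub>A\<^esub> \<one>\<^bsub>A\<^esub>) \<otimes>\<^bsub>A\<^esub> x = c \<odot>\<^bsub>A\<^esub> x"
  by (simp add: smult_mult_left)

text \<open>By \<open>nontrivial\<close>, the homomorphism sending a scalar to its multiple of the
  unit has a subfield as its image; the library's results on spans, bases and dimension then apply
  over it.\<close>

lemma subfield_scalars: "subfield (scalars K A) A"
proof -
  have "ring_hom_ring K A (\<lambda>c. c \<odot>\<^bsub>A\<^esub> \<one>\<^bsub>A\<^esub>)"
    by (rule ring_hom_ringI)
      (simp_all add: K.ring_axioms A.ring_axioms smult_closed smult_l_distr smult_one scalar_mult smult_assoc1)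
  from ring_hom_ring.img_is_subfield(2)[OF this K.carrier_is_subfield nontrivial]
  show ?thesis by (simp add: scalars_def)
qed

text \<open>The library's \<open>subalgebra\<close> asks for an additive subgroup stable under the
  scalars, not for closure under multiplication, so it is a linear subspace.\<close>

abbreviation subspace :: "'a set \<Rightarrow> bool"
  where "subspace V \<equiv> subalgebra (scalars K A) V A"

lemma subspaceI:
  assumes "V \<subseteq> carrier A" and "\<zero>\<^bsub>A\<^esub> \<in> V"
    and "\<And>x y. x \<in> V \<Longrightarrow> y \<in> V \<Longrightarrow> x \<oplus>\<^bsub>A\<^esub> y \<in> V"
    and smult: "\<And>c x. c \<in> carrier K \<Longrightarrow> x \<in> V \<Longrightarrow> c \<odot>\<^bsub>A\<^esub> x \<in> V"
  shows "subspace V"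
proof (intro subalgebra.intro subalgebra_axioms.intro)
  have "\<ominus>\<^bsub>A\<^esub> x \<in> V" if "x \<in> V" for x
  proof -
    have "\<ominus>\<^bsub>A\<^esub> x = (\<ominus>\<^bsub>K\<^esub> \<one>\<^bsub>K\<^esub>) \<odot>\<^bsub>A\<^esub> x"
      using that assms(1) by (subst smult_l_minus) (auto simp: smult_one)
    then show ?thesis using smult[OF _ that] by simp
  qed
  then show "subgroup V (add_monoid A)"
    using assms by (intro A.add.subgroupI) auto
  show "k \<otimes>\<^bsub>A\<^esub> v \<in> V" if "k \<in> scalars K A" "v \<in> V" for k v
    using that assms(1) smult by (auto simp: scalars_def scalar_mult)
qed

lemma subspaceD:
  assumes "subspace V"
  shows subspace_carrier: "V \<subseteq> carrier A" and subspace_zero: "\<zero>\<^bsub>A\<^esub> \<in> V"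
    and subspace_add: "\<And>x y. x \<in> V \<Longrightarrow> y \<in> V \<Longrightarrow> x \<oplus>\<^bsub>A\<^esub> y \<in> V"
    and subspace_smult: "\<And>c x. c \<in> carrier K \<Longrightarrow> x \<in> V \<Longrightarrow> c \<odot>\<^bsub>A\<^esub> x \<in> V"
    and subspace_minus: "\<And>x. x \<in> V \<Longrightarrow> \<ominus>\<^bsub>A\<^esub> x \<in> V"
proof -
  interpret V: subgroup V "add_monoid A" using assms by (rule subalgebra.axioms)
  show sub: "V \<subseteq> carrier A" using V.subset by simp
  show "\<zero>\<^bsub>A\<^esub> \<in> V" using V.one_closed by simp
  show "x \<oplus>\<^bsub>A\<^esub> y \<in> V" if "x \<in> V" "y \<in> V" for x y using V.m_closed that by simp
  show "c \<odot>\<^bsub>A\<^esub> x \<in> V" if "c \<in> carrier K" "x \<in> V" for c x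
  proof -
    have "(c \<odot>\<^bsub>A\<^esub> \<one>\<^bsub>A\<^esub>) \<otimes>\<^bsub>A\<^esub> x \<in> V"
      using that by (intro subalgebra.smult_closed[OF assms]) (auto simp: scalars_def)
    then show ?thesis using that sub scalar_mult by (metis subsetD)
  qed
  show "\<ominus>\<^bsub>A\<^esub> x \<in> V" if "x \<in> V" for x
    using V.m_inv_closed[OF that] by (simp add: a_inv_def)
qed

text \<open>\<open>linear_span\<close> is a union over lists; for a finite set a list of all its
  elements has the largest span, so it suffices.\<close>

lemma linear_span_set:
  assumes "set us \<subseteq> carrier A"
  shows "linear_span K A (set us) = ring.Span A (scalars K A) us"
  unfolding linear_span_def using A.mono_Span_sublist[OF subfield_scalars _ assms] by blast

lemma linear_span_finite:
  assumes "finite T" and "T \<subseteq> carrier A"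
  shows subspace_linear_span: "subspace (linear_span K A T)"
    and linear_span_superset: "T \<subseteq> linear_span K A T"
    and linear_span_minimal: "\<And>V. subspace V \<Longrightarrow> T \<subseteq> V \<Longrightarrow> linear_span K A T \<subseteq> V"
    and finite_dimension_linear_span: "ring.finite_dimension A (scalars K A) (linear_span K A T)"
proof -
  obtain us where us: "set us = T" using finite_list[OF assms(1)] by blast
  have eq: "linear_span K A T = ring.Span A (scalars K A) us"
    using linear_span_set us assms(2) by blast
  show "subspace (linear_span K A T)" "T \<subseteq> linear_span K A T"
    "\<And>V. subspace V \<Longrightarrow> T \<subseteq> V \<Longrightarrow> linear_span K A T \<subseteq> V"
    "ring.finite_dimension A (scalars K A) (linear_span K A T)"
    unfolding eq using us assms(2) A.Span_is_subalgebra[OF subfield_scalars]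
      A.Span_base_incl[OF subfield_scalars] A.subalgebra_Span_incl[OF subfield_scalars]
      A.Span_finite_dimension[OF subfield_scalars] by blast+
qed

text \<open>A basis of \<open>V\<close> is an independent list in \<open>W\<close>, and such a list
  is no longer than the dimension of \<open>W\<close>.\<close>

lemma dim_mono:
  assumes "ring.finite_dimension A (scalars K A) V" and "ring.finite_dimension A (scalars K A) W"
    and "V \<subseteq> W"
  shows "ring.dim A (scalars K A) V \<le> ring.dim A (scalars K A) W"
proof -
  have V: "ring.dimension A (ring.dim A (scalars K A) V) (scalars K A) V"
    and W: "ring.dimension A (ring.dim A (scalars K A) W) (scalars K A) W"
    using A.finite_dimensionE[OF subfield_scalars] assms by (auto simp: over_def)
  obtain us where us: "set us \<subseteq> carrier A" "ring.independent A (scalars K A) us"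
      "length us = ring.dim A (scalars K A) V" "ring.Span A (scalars K A) us = V"
    using A.exists_base[OF subfield_scalars V] by blast
  have "set us \<subseteq> W" using A.Span_base_incl[OF subfield_scalars us(1)] us(4) assms(3) by blast
  then show ?thesis
    using A.independent_length_le_dimension[OF subfield_scalars W us(2)] us(3) by simp
qed

lemma word_prod_closed: "set w \<subseteq> carrier A \<Longrightarrow> word_prod A w \<in> carrier A"
  by (induction w) (auto simp: word_prod_def)

lemma word_prod_append:
  "set v \<subseteq> carrier A \<Longrightarrow> set w \<subseteq> carrier A \<Longrightarrow>
    word_prod A (v @ w) = word_prod A v \<otimes>\<^bsub>A\<^esub> word_prod A w"
proof (induction v)
  case Nil
  then show ?case using word_prod_closed by (simp add: word_prod_def)
next
  case (Cons x v)
  have "word_prod A v \<in> carrier A" "word_prod A w \<in> carrier A"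
    using Cons.prems word_prod_closed by auto
  then show ?case using Cons by (auto simp: word_prod_def A.m_assoc)
qed

lemma products_upto_carrier: "S \<subseteq> carrier A \<Longrightarrow> products_upto A S n \<subseteq> carrier A"
  unfolding products_upto_def using word_prod_closed by auto

lemma finite_products_upto: "finite S \<Longrightarrow> finite (products_upto A S n)"
  unfolding products_upto_def by (intro finite_imageI finite_lists_length_le)

lemma products_upto_mult:
  assumes "S \<subseteq> carrier A" and "x \<in> products_upto A S m" and "y \<in> products_upto A S n"
  shows "x \<otimes>\<^bsub>A\<^esub> y \<in> products_upto A S (m + n)"
proof -
  obtain v w where v: "x = word_prod A v" "set v \<subseteq> S" "length v \<le> m"
    and w: "y = word_prod A w" "set w \<subseteq> S" "length w \<le> n"
    using assms(2,3) unfolding products_upto_def by blast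
  have "x \<otimes>\<^bsub>A\<^esub> y = word_prod A (v @ w)"
    using v w assms(1) by (subst word_prod_append) auto
  moreover have "set (v @ w) \<subseteq> S" "length (v @ w) \<le> m + n" using v w by auto
  ultimately show ?thesis unfolding products_upto_def by blast
qed

end

section \<open>The filtration by length of products\<close>

locale finite_subset_algebra = field_algebra K A
  for K :: "('k, 'm) ring_scheme" and A :: "('k, 'a, 'n) module_scheme" +
  fixes S :: "'a set"
  assumes finite_S: "finite S" and S_carrier: "S \<subseteq> carrier A"
begin

definition V :: "nat \<Rightarrow> 'a set"
  where "V n = linear_span K A (products_upto A S n)"

lemmas products_finite = finite_products_upto[OF finite_S]
  and products_carrier = products_upto_carrier[OF S_carrier]

lemma subspace_V: "subspace (V n)"
  and products_subset_V: "products_upto A S n \<subseteq> V n"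
  and V_minimal: "\<And>W. subspace W \<Longrightarrow> products_upto A S n \<subseteq> W \<Longrightarrow> V n \<subseteq> W"
  and finite_dimension_V: "ring.finite_dimension A (scalars K A) (V n)"
  unfolding V_def using linear_span_finite[OF products_finite products_carrier] by blast+

lemma V_carrier: "V n \<subseteq> carrier A"
  by (rule subspace_carrier[OF subspace_V])

lemma V_mono: "m \<le> n \<Longrightarrow> V m \<subseteq> V n"
proof (rule V_minimal[OF subspace_V])
  assume "m \<le> n"
  then have "products_upto A S m \<subseteq> products_upto A S n" unfolding products_upto_def by auto
  then show "products_upto A S m \<subseteq> V n" using products_subset_V by blast
qed

lemma one_in_V: "\<one>\<^bsub>A\<^esub> \<in> V n"
proof -
  have "word_prod A [] \<in> products_upto A S n" unfolding products_upto_def by (intro imageI) auto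
  then show ?thesis using products_subset_V by (auto simp: word_prod_def)
qed

lemma S_subset_V: "S \<subseteq> V 1"
proof
  fix x assume x: "x \<in> S"
  then have "word_prod A [x] \<in> products_upto A S 1" unfolding products_upto_def by (intro imageI) auto
  moreover have "word_prod A [x] = x" using x S_carrier by (auto simp: word_prod_def)
  ultimately show "x \<in> V 1" using products_subset_V by auto
qed

text \<open>Bilinearity in two passes: for a fixed product \<open>u\<close> of generators, the
  \<open>y\<close> whose product with \<open>u\<close> lies in \<open>V (m + n)\<close> form a
  subspace containing the generating products of \<open>V n\<close>, hence all of
  \<open>V n\<close>; then the left factor is varied in the same way.\<close>

lemma V_mult:
  assumes "x \<in> V m" and "y \<in> V n"
  shows "x \<otimes>\<^bsub>A\<^esub> y \<in> V (m + n)"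
proof -
  note sub = subspaceD[OF subspace_V[of "m + n"]]
  have P: "u \<otimes>\<^bsub>A\<^esub> y \<in> V (m + n)" if u: "u \<in> products_upto A S m" "y \<in> V n" for u y
  proof -
    have uc: "u \<in> carrier A" using u products_carrier by blast
    have "V n \<subseteq> {y \<in> carrier A. u \<otimes>\<^bsub>A\<^esub> y \<in> V (m + n)}"
    proof (rule V_minimal[OF subspaceI])
      show "products_upto A S n \<subseteq> {y \<in> carrier A. u \<otimes>\<^bsub>A\<^esub> y \<in> V (m + n)}"
        using products_upto_mult[OF S_carrier u(1)] products_subset_V products_carrier by blast
    qed (use uc sub in \<open>auto simp: A.r_distr smult_mult_right smult_closed\<close>)
    then show ?thesis using u(2) by blast
  qed
  have yc: "y \<in> carrier A" using assms(2) V_carrier by blast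
  have "V m \<subseteq> {x \<in> carrier A. x \<otimes>\<^bsub>A\<^esub> y \<in> V (m + n)}"
  proof (rule V_minimal[OF subspaceI])
    show "products_upto A S m \<subseteq> {x \<in> carrier A. x \<otimes>\<^bsub>A\<^esub> y \<in> V (m + n)}"
      using P[OF _ assms(2)] products_carrier by blast
  qed (use yc sub in \<open>auto simp: A.l_distr smult_mult_left smult_closed\<close>)
  then show ?thesis using assms(1) by blast
qed

lemma word_prod_in_V: "set w \<subseteq> V d \<Longrightarrow> word_prod A w \<in> V (d * length w)"
proof (induction w)
  case Nil
  then show ?case using one_in_V by (simp add: word_prod_def)
next
  case (Cons x w)
  then have "x \<otimes>\<^bsub>A\<^esub> word_prod A w \<in> V (d + d * length w)" by (intro V_mult) auto
  then show ?case by (simp add: word_prod_def)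
qed

text \<open>The union of the increasing subspaces \<open>V n\<close> contains the scalars and
  \<open>S\<close> and is closed under the ring operations, so the filtration exhausts the generated
  algebra.\<close>

lemma generate_ring_in_V:
  assumes "x \<in> generate_ring A (scalars K A \<union> S)"
  shows "\<exists>n. x \<in> V n"
  using assms
proof (induction rule: generate_ring.induct)
  case one
  then show ?case using one_in_V by blast
next
  case (incl h)
  then consider c where "c \<in> carrier K" "h = c \<odot>\<^bsub>A\<^esub> \<one>\<^bsub>A\<^esub>" | "h \<in> S"
    unfolding scalars_def by blast
  then show ?case
    using one_in_V subspace_smult[OF subspace_V] S_subset_V by cases blast+
next
  case (a_inv h)
  then show ?case using subspace_minus[OF subspace_V] by blast
next
  case (eng_add x y)
  then obtain m n where "x \<in> V m" "y \<in> V n" by blast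
  then have "x \<in> V (max m n)" "y \<in> V (max m n)"
    using V_mono[of m "max m n"] V_mono[of n "max m n"] by auto
  then show ?case using subspace_add[OF subspace_V] by blast
next
  case (eng_mult x y)
  then show ?case using V_mult by blast
qed

lemma finite_subset_V:
  assumes "generates_algebra K A S" and "finite T" and "T \<subseteq> carrier A"
  obtains d where "d > 0" and "T \<subseteq> V d"
proof -
  have "\<exists>d. T \<subseteq> V d" using assms(2,3)
  proof (induction T)
    case (insert x T)
    obtain d where "T \<subseteq> V d" using insert by auto
    moreover have "x \<in> generate_ring A (scalars K A \<union> S)"
      using insert.prems assms(1) unfolding generates_algebra_def by auto
    then obtain e where "x \<in> V e" using generate_ring_in_V by blast
    ultimately have "insert x T \<subseteq> V (max d e)"
      using V_mono[of d "max d e"] V_mono[of e "max d e"] by auto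
    then show ?case by blast
  qed simp
  then obtain d where "T \<subseteq> V d" by blast
  \<comment> \<open>The dilation in a comparison of growth functions has to be positive.\<close>
  then have "T \<subseteq> V (Suc d)" using V_mono[of d "Suc d"] by auto
  then show ?thesis using that by blast
qed

end

text \<open>The elements of \<open>S\<close> lie in \<open>T.V d\<close> for some \<open>d\<close>,
  hence products of at most \<open>n\<close> of them lie in \<open>T.V (d * n)\<close>: the constant
  is 1 and the dilation is \<open>d\<close>.\<close>

lemma (in field_algebra) growth_function_independent:
  assumes "finite S" "generates_algebra K A S" "finite T" "generates_algebra K A T"
  shows "growth_function K A S \<preceq>\<^sub>g growth_function K A T"
proof -
  have SC: "S \<subseteq> carrier A" and TC: "T \<subseteq> carrier A"
    using assms unfolding generates_algebra_def by auto
  interpret S: finite_subset_algebra K A S by unfold_locales (use assms SC in auto)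
  interpret T: finite_subset_algebra K A T by unfold_locales (use assms TC in auto)
  obtain d where d: "d > 0" "S \<subseteq> T.V d" using T.finite_subset_V[OF assms(4,1) SC] by blast
  have "growth_function K A S n \<le> growth_function K A T (d * n)" for n
  proof -
    have "S.V n \<subseteq> T.V (d * n)"
    proof (rule S.V_minimal[OF T.subspace_V], rule subsetI)
      fix x assume "x \<in> products_upto A S n"
      then obtain w where w: "x = word_prod A w" "set w \<subseteq> S" "length w \<le> n"
        unfolding products_upto_def by blast
      then have "x \<in> T.V (d * length w)" using T.word_prod_in_V[of w d] d by blast
      then show "x \<in> T.V (d * n)" using T.V_mono[of "d * length w" "d * n"] w by auto
    qed
    from dim_mono[OF S.finite_dimension_V T.finite_dimension_V this]
    show ?thesis unfolding growth_function_def S.V_def T.V_def .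
  qed
  then show ?thesis unfolding growth_le_def
    using d(1) by (intro exI[of _ "1::real"] exI[of _ d]) auto
qed

section \<open>Monomial algebras\<close>

text \<open>This is \<open>\<Sum> a u * b v\<close> over all factorizations \<open>w = u @ v\<close>; the recursion on \<open>w\<close> avoids
  reindexing double sums in the proof of associativity.\<close>

primrec conv :: "('k, 'm) ring_scheme \<Rightarrow> ('l list \<Rightarrow> 'k) \<Rightarrow> ('l list \<Rightarrow> 'k) \<Rightarrow> 'l list \<Rightarrow> 'k"
  where
    "conv K a b [] = a [] \<otimes>\<^bsub>K\<^esub> b []"
  | "conv K a b (c # w) = a [] \<otimes>\<^bsub>K\<^esub> b (c # w) \<oplus>\<^bsub>K\<^esub> conv K (\<lambda>u. a (c # u)) b w"

definition delta :: "('k, 'm) ring_scheme \<Rightarrow> 'l list \<Rightarrow> 'l list \<Rightarrow> 'k"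
  where "delta K w u = (if u = w then \<one>\<^bsub>K\<^esub> else \<zero>\<^bsub>K\<^esub>)"

section \<open>Calculus of the convolution product\<close>

context cring
begin

lemma conv_closed:
  "(\<And>w. a w \<in> carrier R) \<Longrightarrow> (\<And>w. b w \<in> carrier R) \<Longrightarrow> conv R a b w \<in> carrier R"
  by (induction w arbitrary: a) auto

text \<open>Only prefixes of \<open>w\<close> enter the left factor and only suffixes the right one;
  this allows a product truncated to a language to be replaced by the full convolution.\<close>

lemma conv_cong:
  assumes "\<And>u v. w = u @ v \<Longrightarrow> a u = a' u" and "\<And>u v. w = u @ v \<Longrightarrow> b v = b' v"
  shows "conv R a b w = conv R a' b' w"
  using assms
proof (induction w arbitrary: a a')
  case (Cons c w)
  have "conv R (\<lambda>u. a (c # u)) b w = conv R (\<lambda>u. a' (c # u)) b' w"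
  proof (rule Cons.IH)
    show "a (c # u) = a' (c # u)" if "w = u @ v" for u v using Cons.prems(1)[of "c # u"] that by simp
    show "b v = b' v" if "w = u @ v" for u v using Cons.prems(2)[of "c # u"] that by simp
  qed
  moreover have "a [] = a' []" "b (c # w) = b' (c # w)"
    using Cons.prems(1)[of "[]"] Cons.prems(2)[of "[]"] by auto
  ultimately show ?case by simp
qed simp

lemma conv_zero_left: "(\<And>w. b w \<in> carrier R) \<Longrightarrow> conv R (\<lambda>_. \<zero>) b w = \<zero>"
  by (induction w) auto

text \<open>It bounds the support of a product by concatenations, which yields its finiteness and,
  later, lower bounds on letter counts.\<close>

lemma conv_nonzero:
  assumes "\<And>w. a w \<in> carrier R" and "\<And>w. b w \<in> carrier R" and "conv R a b w \<noteq> \<zero>"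
  obtains u v where "w = u @ v" and "a u \<noteq> \<zero>" and "b v \<noteq> \<zero>"
proof -
  have "\<exists>u v. w = u @ v \<and> a u \<noteq> \<zero> \<and> b v \<noteq> \<zero>"
    using assms(1,3)
  proof (induction w arbitrary: a)
    case Nil
    then show ?case using assms(2) by auto
  next
    case (Cons c w)
    show ?case
    proof (cases "a [] \<noteq> \<zero> \<and> b (c # w) \<noteq> \<zero>")
      case True
      then show ?thesis by force
    next
      case False
      then have "a [] \<otimes> b (c # w) = \<zero>" using Cons.prems(1) assms(2) by auto
      then have "conv R (\<lambda>u. a (c # u)) b w \<noteq> \<zero>" using Cons.prems by auto
      then obtain u v where "w = u @ v" "a (c # u) \<noteq> \<zero>" "b v \<noteq> \<zero>"
        using Cons.IH[of "\<lambda>u. a (c # u)"] Cons.prems(1) by blast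
      then show ?thesis by (metis append_Cons)
    qed
  qed
  then show ?thesis using that by blast
qed

lemma conv_add_left:
  assumes "\<And>w. a w \<in> carrier R" and "\<And>w. a' w \<in> carrier R" and "\<And>w. b w \<in> carrier R"
  shows "conv R (\<lambda>w. a w \<oplus> a' w) b w = conv R a b w \<oplus> conv R a' b w"
  using assms(1,2)
proof (induction w arbitrary: a a')
  case Nil
  then show ?case using assms(3) by (simp add: l_distr)
next
  case (Cons c w)
  have cl: "conv R (\<lambda>u. a (c # u)) b w \<in> carrier R" "conv R (\<lambda>u. a' (c # u)) b w \<in> carrier R"
    using Cons.prems assms(3) by (auto intro: conv_closed)
  have "conv R (\<lambda>u. a (c # u) \<oplus> a' (c # u)) b w = conv R (\<lambda>u. a (c # u)) b w \<oplus> conv R (\<lambda>u. a' (c # u)) b w"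
    using Cons.prems by (intro Cons.IH) auto
  then show ?case using cl Cons.prems assms(3) by (simp add: l_distr a_ac)
qed

lemma conv_add_right:
  assumes "\<And>w. a w \<in> carrier R" and "\<And>w. b w \<in> carrier R" and "\<And>w. b' w \<in> carrier R"
  shows "conv R a (\<lambda>w. b w \<oplus> b' w) w = conv R a b w \<oplus> conv R a b' w"
  using assms(1)
proof (induction w arbitrary: a)
  case Nil
  then show ?case using assms(2,3) by (simp add: r_distr)
next
  case (Cons c w)
  have cl: "conv R (\<lambda>u. a (c # u)) b w \<in> carrier R" "conv R (\<lambda>u. a (c # u)) b' w \<in> carrier R"
    using Cons.prems assms by (auto intro: conv_closed)
  then show ?case using Cons.prems assms(2,3) Cons.IH[of "\<lambda>u. a (c # u)"] by (simp add: r_distr a_ac)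
qed

lemma conv_smult_left:
  assumes "k \<in> carrier R" and "\<And>w. a w \<in> carrier R" and "\<And>w. b w \<in> carrier R"
  shows "conv R (\<lambda>w. k \<otimes> a w) b w = k \<otimes> conv R a b w"
  using assms(2)
proof (induction w arbitrary: a)
  case Nil
  then show ?case using assms(1,3) by (simp add: m_assoc)
next
  case (Cons c w)
  have cl: "conv R (\<lambda>u. a (c # u)) b w \<in> carrier R"
    using Cons.prems assms by (auto intro: conv_closed)
  then show ?case using Cons.prems assms(1,3) Cons.IH[of "\<lambda>u. a (c # u)"]
    by (simp add: r_distr m_assoc)
qed

lemma conv_smult_right:
  assumes "k \<in> carrier R" and "\<And>w. a w \<in> carrier R" and "\<And>w. b w \<in> carrier R"
  shows "conv R a (\<lambda>w. k \<otimes> b w) w = k \<otimes> conv R a b w"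
  using assms(2)
proof (induction w arbitrary: a)
  case Nil
  then show ?case using assms(1,3) by (simp add: m_lcomm)
next
  case (Cons c w)
  have cl: "conv R (\<lambda>u. a (c # u)) b w \<in> carrier R"
    using Cons.prems assms by (auto intro: conv_closed)
  then show ?case using Cons.prems assms(1,3) Cons.IH[of "\<lambda>u. a (c # u)"]
    by (simp add: r_distr m_lcomm)
qed

text \<open>Removing the first letter turns \<open>conv R a b\<close> into \<open>a []\<close> times
  the shifted \<open>b\<close> plus \<open>conv\<close> of the shifted \<open>a\<close> with
  \<open>b\<close>; linearity in the left argument and the induction hypothesis for the shifted
  \<open>a\<close> do the rest.\<close>

lemma conv_assoc:
  assumes "\<And>w. a w \<in> carrier R" and "\<And>w. b w \<in> carrier R" and "\<And>w. d w \<in> carrier R"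
  shows "conv R (conv R a b) d w = conv R a (conv R b d) w"
  using assms(1)
proof (induction w arbitrary: a)
  case Nil
  then show ?case using assms(2,3) by (simp add: m_assoc)
next
  case (Cons c w)
  let ?a = "\<lambda>u. a (c # u)" and ?b = "\<lambda>u. b (c # u)"
  have cl: "conv R ?b d w \<in> carrier R" "conv R (conv R ?a b) d w \<in> carrier R"
    using Cons.prems assms by (auto intro!: conv_closed)
  have "conv R (\<lambda>u. a [] \<otimes> b (c # u) \<oplus> conv R ?a b u) d w
      = conv R (\<lambda>u. a [] \<otimes> b (c # u)) d w \<oplus> conv R (conv R ?a b) d w"
    using Cons.prems assms by (intro conv_add_left) (auto intro!: conv_closed)
  also have "conv R (\<lambda>u. a [] \<otimes> b (c # u)) d w = a [] \<otimes> conv R ?b d w"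
    using Cons.prems assms by (intro conv_smult_left) auto
  also have "conv R (conv R ?a b) d w = conv R ?a (conv R b d) w"
    using Cons.prems by (intro Cons.IH)
  finally show ?case using cl Cons.prems assms(2,3) Cons.IH[of ?a]
    by (simp add: r_distr m_assoc a_assoc)
qed

lemma delta_closed: "delta R w u \<in> carrier R"
  by (simp add: delta_def)

lemma delta_Cons: "(\<lambda>u. delta R (c # w) (d # u)) = (if d = c then delta R w else (\<lambda>_. \<zero>))"
  by (auto simp: delta_def fun_eq_iff)

lemma conv_delta_Nil_left: "(\<And>w. b w \<in> carrier R) \<Longrightarrow> conv R (delta R []) b w = b w"
proof (cases w)
  case (Cons c v)
  assume b: "\<And>w. b w \<in> carrier R"
  have "(\<lambda>u. delta R [] (c # u)) = (\<lambda>_. \<zero>)" by (simp add: delta_def)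
  then show ?thesis using b Cons by (simp add: conv_zero_left delta_def)
qed (simp add: delta_def)

lemma conv_delta_Nil_right: "(\<And>w. a w \<in> carrier R) \<Longrightarrow> conv R a (delta R []) w = a w"
  by (induction w arbitrary: a) (auto simp: delta_def)

lemma conv_delta_singleton:
  assumes "\<And>w. b w \<in> carrier R"
  shows "conv R (delta R [c]) b w = (case w of [] \<Rightarrow> \<zero> | d # v \<Rightarrow> if d = c then b v else \<zero>)"
proof (cases w)
  case Nil
  then show ?thesis using assms by (simp add: delta_def)
next
  case (Cons d v)
  have "delta R [c] [] = \<zero>" by (simp add: delta_def)
  then show ?thesis using assms Cons
    by (auto simp: delta_Cons conv_delta_Nil_left conv_zero_left)
qed

text \<open>The recursion at the last letter, mirroring the defining one at the first
  letter.\<close>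

lemma conv_snoc:
  assumes "\<And>w. a w \<in> carrier R" and "\<And>w. b w \<in> carrier R"
  shows "conv R a b (w @ [c]) = conv R a (\<lambda>u. b (u @ [c])) w \<oplus> a (w @ [c]) \<otimes> b []"
  using assms(1)
proof (induction w arbitrary: a)
  case (Cons d w)
  have "conv R (\<lambda>u. a (d # u)) (\<lambda>u. b (u @ [c])) w \<in> carrier R"
    using Cons.prems assms by (auto intro: conv_closed)
  then show ?case using Cons.prems assms(2) Cons.IH[of "\<lambda>u. a (d # u)"] by (simp add: a_assoc)
qed simp

text \<open>Along powers of one letter the product is that of ordinary polynomials. One side is
  expanded at the first letter and the other at the last, and the results agree because all letters
  are equal.\<close>

lemma conv_replicate_commute:
  assumes "\<And>w. a w \<in> carrier R" and "\<And>w. b w \<in> carrier R"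
  shows "conv R a b (replicate n c) = conv R b a (replicate n c)"
  using assms
proof (induction n arbitrary: a b)
  case 0
  then show ?case by (simp add: m_comm)
next
  case (Suc n)
  have "conv R b a (replicate (Suc n) c) = conv R b a (replicate n c @ [c])"
    by (simp add: replicate_append_same)
  also have "\<dots> = conv R b (\<lambda>u. a (u @ [c])) (replicate n c) \<oplus> b (replicate n c @ [c]) \<otimes> a []"
    using Suc.prems by (intro conv_snoc)
  also have "conv R b (\<lambda>u. a (u @ [c])) (replicate n c) = conv R b (\<lambda>u. a (c # u)) (replicate n c)"
  proof (rule conv_cong)
    fix u v assume "replicate n c = u @ v"
    then have "v = replicate (length v) c"
      by (metis append_eq_conv_conj drop_replicate length_replicate)
    then show "a (v @ [c]) = a (c # v)" by (metis replicate_append_same)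
  qed simp
  also have "\<dots> = conv R (\<lambda>u. a (c # u)) b (replicate n c)"
    using Suc.prems by (intro Suc.IH[symmetric]) auto
  finally show ?case using Suc.prems conv_closed[of "\<lambda>u. a (c # u)" b "replicate n c"]
    by (simp add: replicate_append_same m_comm a_comm)
qed

end

section \<open>The monomial algebra of a language\<close>

text \<open>For \<open>L\<close> closed under factors, this is the quotient of the free algebra by
  the span of the words outside \<open>L\<close>, on normal forms: products are multiplied out and
  then truncated to \<open>L\<close>.\<close>

definition monomial_algebra :: "('k, 'm) ring_scheme \<Rightarrow> 'l list set \<Rightarrow> ('k, 'l list \<Rightarrow> 'k) module"
  where "monomial_algebra K L = \<lparr>
    carrier = {a. (\<forall>w. a w \<in> carrier K) \<and> finite {w. a w \<noteq> \<zero>\<^bsub>K\<^esub>} \<and> {w. a w \<noteq> \<zero>\<^bsub>K\<^esub>} \<subseteq> L},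
    monoid.mult = (\<lambda>a b w. if w \<in> L then conv K a b w else \<zero>\<^bsub>K\<^esub>),
    monoid.one = delta K [],
    ring.zero = (\<lambda>_. \<zero>\<^bsub>K\<^esub>),
    ring.add = (\<lambda>a b w. a w \<oplus>\<^bsub>K\<^esub> b w),
    module.smult = (\<lambda>c a w. c \<otimes>\<^bsub>K\<^esub> a w)\<rparr>"

locale factorial_language = K: field K for K :: "('k, 'm) ring_scheme" +
  fixes L :: "'l list set"
  assumes factor: "u @ w @ v \<in> L \<Longrightarrow> w \<in> L"
    and Nil_in: "[] \<in> L"
begin

abbreviation A :: "('k, 'l list \<Rightarrow> 'k) module"
  where "A \<equiv> monomial_algebra K L"

lemma carrier_iff: "a \<in> carrier A \<longleftrightarrow>
    (\<forall>w. a w \<in> carrier K) \<and> finite {w. a w \<noteq> \<zero>\<^bsub>K\<^esub>} \<and> {w. a w \<noteq> \<zero>\<^bsub>K\<^esub>} \<subseteq> L"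
  and mult_eq: "a \<otimes>\<^bsub>A\<^esub> b = (\<lambda>w. if w \<in> L then conv K a b w else \<zero>\<^bsub>K\<^esub>)"
  and one_eq: "\<one>\<^bsub>A\<^esub> = delta K []"
  and zero_eq: "\<zero>\<^bsub>A\<^esub> = (\<lambda>_. \<zero>\<^bsub>K\<^esub>)"
  and add_eq: "a \<oplus>\<^bsub>A\<^esub> b = (\<lambda>w. a w \<oplus>\<^bsub>K\<^esub> b w)"
  and smult_eq: "c \<odot>\<^bsub>A\<^esub> a = (\<lambda>w. c \<otimes>\<^bsub>K\<^esub> a w)"
  by (simp_all add: monomial_algebra_def)

lemma coeff_closed: "a \<in> carrier A \<Longrightarrow> a w \<in> carrier K"
  by (simp add: carrier_iff)

lemma coeff_outside: "a \<in> carrier A \<Longrightarrow> w \<notin> L \<Longrightarrow> a w = \<zero>\<^bsub>K\<^esub>"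
  by (auto simp: carrier_iff)

lemma prefix_in: "u @ v \<in> L \<Longrightarrow> u \<in> L" and suffix_in: "u @ v \<in> L \<Longrightarrow> v \<in> L"
  using factor[of "[]" u v] factor[of u v "[]"] by auto

lemma mult_closed:
  assumes "a \<in> carrier A" and "b \<in> carrier A"
  shows "a \<otimes>\<^bsub>A\<^esub> b \<in> carrier A"
proof -
  have "{w. (a \<otimes>\<^bsub>A\<^esub> b) w \<noteq> \<zero>\<^bsub>K\<^esub>} \<subseteq> (\<lambda>(u, v). u @ v) ` ({w. a w \<noteq> \<zero>\<^bsub>K\<^esub>} \<times> {w. b w \<noteq> \<zero>\<^bsub>K\<^esub>})"
  proof
    fix w assume "w \<in> {w. (a \<otimes>\<^bsub>A\<^esub> b) w \<noteq> \<zero>\<^bsub>K\<^esub>}"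
    then have "conv K a b w \<noteq> \<zero>\<^bsub>K\<^esub>" by (simp add: mult_eq split: if_splits)
    then obtain u v where "w = u @ v" "a u \<noteq> \<zero>\<^bsub>K\<^esub>" "b v \<noteq> \<zero>\<^bsub>K\<^esub>"
      using K.conv_nonzero coeff_closed assms by metis
    then show "w \<in> (\<lambda>(u, v). u @ v) ` ({w. a w \<noteq> \<zero>\<^bsub>K\<^esub>} \<times> {w. b w \<noteq> \<zero>\<^bsub>K\<^esub>})" by auto
  qed
  moreover have "finite ({w. a w \<noteq> \<zero>\<^bsub>K\<^esub>} \<times> {w. b w \<noteq> \<zero>\<^bsub>K\<^esub>})"
    using assms by (simp add: carrier_iff)
  ultimately have "finite {w. (a \<otimes>\<^bsub>A\<^esub> b) w \<noteq> \<zero>\<^bsub>K\<^esub>}" using finite_subset by blast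
  then show ?thesis unfolding carrier_iff
    using assms by (auto simp: mult_eq coeff_closed intro!: K.conv_closed)
qed

text \<open>Prefixes and suffixes of words of \<open>L\<close> are in \<open>L\<close>, so
  truncating the inner product does not affect coefficients at words of \<open>L\<close>, and
  associativity reduces to that of \<open>conv\<close>.\<close>

lemma mult_assoc:
  assumes "a \<in> carrier A" and "b \<in> carrier A" and "d \<in> carrier A"
  shows "(a \<otimes>\<^bsub>A\<^esub> b) \<otimes>\<^bsub>A\<^esub> d = a \<otimes>\<^bsub>A\<^esub> (b \<otimes>\<^bsub>A\<^esub> d)"
proof
  fix w
  show "((a \<otimes>\<^bsub>A\<^esub> b) \<otimes>\<^bsub>A\<^esub> d) w = (a \<otimes>\<^bsub>A\<^esub> (b \<otimes>\<^bsub>A\<^esub> d)) w"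
  proof (cases "w \<in> L")
    case True
    have "conv K (a \<otimes>\<^bsub>A\<^esub> b) d w = conv K (conv K a b) d w"
      using True prefix_in by (intro K.conv_cong) (auto simp: mult_eq)
    also have "\<dots> = conv K a (conv K b d) w"
      using assms coeff_closed by (intro K.conv_assoc) auto
    also have "\<dots> = conv K a (b \<otimes>\<^bsub>A\<^esub> d) w"
      using True suffix_in by (intro K.conv_cong) (auto simp: mult_eq)
    finally show ?thesis using True mult_eq by metis
  qed (simp add: mult_eq)
qed

lemma add_closed: "a \<in> carrier A \<Longrightarrow> b \<in> carrier A \<Longrightarrow> a \<oplus>\<^bsub>A\<^esub> b \<in> carrier A"
proof -
  assume ab: "a \<in> carrier A" "b \<in> carrier A"
  have sub: "{w. (a \<oplus>\<^bsub>A\<^esub> b) w \<noteq> \<zero>\<^bsub>K\<^esub>} \<subseteq> {w. a w \<noteq> \<zero>\<^bsub>K\<^esub>} \<union> {w. b w \<noteq> \<zero>\<^bsub>K\<^esub>}"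
    by (auto simp: add_eq)
  moreover have "finite ({w. a w \<noteq> \<zero>\<^bsub>K\<^esub>} \<union> {w. b w \<noteq> \<zero>\<^bsub>K\<^esub>})"
    using ab by (simp add: carrier_iff)
  ultimately have "finite {w. (a \<oplus>\<^bsub>A\<^esub> b) w \<noteq> \<zero>\<^bsub>K\<^esub>}" using finite_subset by blast
  then show ?thesis using ab sub unfolding carrier_iff by (auto simp: add_eq)
qed

lemma smult_closed: "c \<in> carrier K \<Longrightarrow> a \<in> carrier A \<Longrightarrow> c \<odot>\<^bsub>A\<^esub> a \<in> carrier A"
proof -
  assume c: "c \<in> carrier K" and a: "a \<in> carrier A"
  have sub: "{w. (c \<odot>\<^bsub>A\<^esub> a) w \<noteq> \<zero>\<^bsub>K\<^esub>} \<subseteq> {w. a w \<noteq> \<zero>\<^bsub>K\<^esub>}"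
    using c by (auto simp: smult_eq)
  then have "finite {w. (c \<odot>\<^bsub>A\<^esub> a) w \<noteq> \<zero>\<^bsub>K\<^esub>}"
    using a finite_subset unfolding carrier_iff by blast
  then show ?thesis using a c sub unfolding carrier_iff by (auto simp: smult_eq)
qed

lemma delta_in_carrier: "w \<in> L \<Longrightarrow> delta K w \<in> carrier A"
  unfolding carrier_iff by (auto simp: delta_def)

lemma zero_in_carrier: "\<zero>\<^bsub>A\<^esub> \<in> carrier A"
  unfolding carrier_iff by (simp add: zero_eq)

lemma abelian_group: "abelian_group A"
proof (rule abelian_groupI)
  fix a assume a: "a \<in> carrier A"
  have "\<ominus>\<^bsub>K\<^esub> \<one>\<^bsub>K\<^esub> \<odot>\<^bsub>A\<^esub> a \<in> carrier A" using a by (simp add: smult_closed)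
  moreover have "(\<ominus>\<^bsub>K\<^esub> \<one>\<^bsub>K\<^esub> \<odot>\<^bsub>A\<^esub> a) \<oplus>\<^bsub>A\<^esub> a = \<zero>\<^bsub>A\<^esub>"
    using a by (simp add: smult_eq add_eq zero_eq fun_eq_iff coeff_closed K.l_minus K.l_neg)
  ultimately show "\<exists>b\<in>carrier A. b \<oplus>\<^bsub>A\<^esub> a = \<zero>\<^bsub>A\<^esub>" by blast
qed (simp_all add: add_closed zero_in_carrier, simp_all add: add_eq zero_eq fun_eq_iff coeff_closed K.a_ac)

lemma monoid: "monoid A"
proof (rule monoidI)
  fix a assume a: "a \<in> carrier A"
  show "\<one>\<^bsub>A\<^esub> \<otimes>\<^bsub>A\<^esub> a = a"
  proof
    fix w show "(\<one>\<^bsub>A\<^esub> \<otimes>\<^bsub>A\<^esub> a) w = a w"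
      using a by (auto simp: mult_eq one_eq K.conv_delta_Nil_left coeff_closed coeff_outside)
  qed
  show "a \<otimes>\<^bsub>A\<^esub> \<one>\<^bsub>A\<^esub> = a"
  proof
    fix w show "(a \<otimes>\<^bsub>A\<^esub> \<one>\<^bsub>A\<^esub>) w = a w"
      using a by (auto simp: mult_eq one_eq K.conv_delta_Nil_right coeff_closed coeff_outside)
  qed
qed (simp_all add: mult_closed mult_assoc one_eq Nil_in delta_in_carrier)

sublocale ring A
  by (rule ringI[OF abelian_group monoid])
    (auto simp: mult_eq add_eq fun_eq_iff coeff_closed K.conv_add_left K.conv_add_right)

lemma assoc_algebra: "assoc_algebra K A"
proof (intro assoc_algebra.intro assoc_algebra_axioms.intro ring_axioms)
  show "module K A"
    by (rule moduleI[OF K.is_cring abelian_group])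
      (simp_all add: smult_closed, simp_all add: smult_eq add_eq fun_eq_iff coeff_closed
        K.l_distr K.r_distr K.m_assoc)
qed (auto simp: mult_eq smult_eq fun_eq_iff coeff_closed K.conv_smult_left K.conv_smult_right)

end

section \<open>The basis of monomials\<close>

context factorial_language
begin

lemma delta_nonzero: "delta K w \<noteq> \<zero>\<^bsub>A\<^esub>"
proof
  assume "delta K w = \<zero>\<^bsub>A\<^esub>"
  then have "delta K w w = \<zero>\<^bsub>K\<^esub>" by (simp add: zero_eq)
  then show False by (simp add: delta_def)
qed

sublocale field_algebra K A
proof (intro field_algebra.intro field_algebra_axioms.intro K.field_axioms ring_axioms)
  show "assoc_algebra K A" by (rule assoc_algebra)
  show "\<one>\<^bsub>A\<^esub> \<noteq> \<zero>\<^bsub>A\<^esub>" unfolding one_eq by (rule delta_nonzero)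
qed

text \<open>Elements have finite support, so they are sums of multiples of monomials; the induction
  removes one word of the support at a time.\<close>

lemma carrier_subset_if_deltas:
  assumes add: "\<And>a b. a \<in> G \<Longrightarrow> b \<in> G \<Longrightarrow> a \<oplus>\<^bsub>A\<^esub> b \<in> G"
    and zero: "\<zero>\<^bsub>A\<^esub> \<in> G"
    and delta: "\<And>c w. c \<in> carrier K \<Longrightarrow> w \<in> L \<Longrightarrow> c \<odot>\<^bsub>A\<^esub> delta K w \<in> G"
  shows "carrier A \<subseteq> G"
proof
  fix a assume a: "a \<in> carrier A"
  then have "finite {w. a w \<noteq> \<zero>\<^bsub>K\<^esub>}" by (simp add: carrier_iff)
  then show "a \<in> G" using a
  proof (induction "{w. a w \<noteq> \<zero>\<^bsub>K\<^esub>}" arbitrary: a rule: finite_induct)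
    case empty
    then have "a = \<zero>\<^bsub>A\<^esub>" by (auto simp: zero_eq fun_eq_iff)
    then show ?case using zero by simp
  next
    case (insert w F)
    define b where "b = (\<lambda>u. if u = w then \<zero>\<^bsub>K\<^esub> else a u)"
    have F: "F = {u. b u \<noteq> \<zero>\<^bsub>K\<^esub>}" using insert.hyps unfolding b_def by auto
    moreover have "b \<in> carrier A"
      using insert.prems insert.hyps(1) F unfolding carrier_iff by (auto simp: b_def split: if_splits)
    ultimately have "b \<in> G" by (rule insert.hyps(3))
    moreover have "a w \<odot>\<^bsub>A\<^esub> delta K w \<in> G"
      using insert.prems insert.hyps(4) by (intro delta) (auto simp: carrier_iff)
    moreover have "a = (a w \<odot>\<^bsub>A\<^esub> delta K w) \<oplus>\<^bsub>A\<^esub> b"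
      using coeff_closed[OF insert.prems] by (auto simp: fun_eq_iff add_eq smult_eq b_def delta_def)
    ultimately show ?case using add by metis
  qed
qed

text \<open>Letters are multiplied from the right. Once a suffix lies outside \<open>L\<close>, so
  does every longer word ending in it, and the zero reached there persists.\<close>

lemma word_prod_deltas:
  "word_prod A (map (\<lambda>c. delta K [c]) w) = (if w \<in> L then delta K w else \<zero>\<^bsub>A\<^esub>)"
proof (induction w)
  case Nil
  then show ?case using Nil_in by (simp add: word_prod_def one_eq)
next
  case (Cons c w)
  let ?x = "if w \<in> L then delta K w else \<zero>\<^bsub>A\<^esub>"
  have cl: "?x v \<in> carrier K" for v by (simp add: zero_eq K.delta_closed)
  have "word_prod A (map (\<lambda>c. delta K [c]) (c # w)) = delta K [c] \<otimes>\<^bsub>A\<^esub> ?x"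
    using Cons by (simp add: word_prod_def)
  also have "\<dots> = (if c # w \<in> L then delta K (c # w) else \<zero>\<^bsub>A\<^esub>)"
  proof
    fix v
    have "w \<in> L" if "c # w \<in> L" using suffix_in[of "[c]" w] that by simp
    then show "(delta K [c] \<otimes>\<^bsub>A\<^esub> ?x) v = (if c # w \<in> L then delta K (c # w) else \<zero>\<^bsub>A\<^esub>) v"
      unfolding mult_eq K.conv_delta_singleton[OF cl] by (cases v) (auto simp: zero_eq delta_def)
  qed
  finally show ?case .
qed

lemma subspace_coeff_zero: "subspace {a \<in> carrier A. a w = \<zero>\<^bsub>K\<^esub>}"
  by (rule subspaceI) (auto simp: zero_in_carrier add_closed smult_closed, auto simp: zero_eq add_eq smult_eq)

text \<open>The coefficient at \<open>w\<close> is a linear functional that vanishes on the other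
  monomials and equals 1 on \<open>delta K w\<close>.\<close>

lemma independent_deltas:
  "distinct ws \<Longrightarrow> set ws \<subseteq> L \<Longrightarrow> ring.independent A (scalars K A) (map (delta K) ws)"
proof (induction ws)
  case (Cons w ws)
  have "ring.Span A (scalars K A) (map (delta K) ws) \<subseteq> {a \<in> carrier A. a w = \<zero>\<^bsub>K\<^esub>}"
    using Cons.prems delta_in_carrier
    by (intro subalgebra_Span_incl[OF subfield_scalars subspace_coeff_zero]) (auto simp: delta_def)
  then have "delta K w \<notin> ring.Span A (scalars K A) (map (delta K) ws)"
    by (auto simp: delta_def)
  then show ?case using Cons delta_in_carrier by (auto intro: li_Cons)
qed simp

end

section \<open>Growth over a finite alphabet\<close>

locale finite_alphabet_language = factorial_language K L
  for K :: "('k, 'm) ring_scheme" and L :: "'l list set" +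
  fixes C :: "'l set"
  assumes finite_alphabet: "finite C"
    and L_lists: "L \<subseteq> lists C"
    and letters_in: "\<And>c. c \<in> C \<Longrightarrow> [c] \<in> L"
begin

definition gens :: "('l list \<Rightarrow> 'k) set"
  where "gens = (\<lambda>c. delta K [c]) ` C"

lemma finite_gens: "finite gens" and gens_carrier: "gens \<subseteq> carrier A"
  using finite_alphabet letters_in delta_in_carrier by (auto simp: gens_def)

lemma products_upto_gens_subset:
  "products_upto A gens n \<subseteq> insert \<zero>\<^bsub>A\<^esub> (delta K ` {w \<in> L. length w \<le> n})"
proof
  fix x assume "x \<in> products_upto A gens n"
  then obtain v where v: "x = word_prod A v" "set v \<subseteq> gens" "length v \<le> n"
    unfolding products_upto_def by blast
  have "v \<in> lists ((\<lambda>c. delta K [c]) ` C)" using v(2) by (auto simp: gens_def)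
  then obtain w where "v = map (\<lambda>c. delta K [c]) w" unfolding lists_image by blast
  then show "x \<in> insert \<zero>\<^bsub>A\<^esub> (delta K ` {w \<in> L. length w \<le> n})"
    using v word_prod_deltas[of w] by auto
qed

lemma delta_in_products_upto:
  assumes "w \<in> L" and "length w \<le> n"
  shows "delta K w \<in> products_upto A gens n"
proof -
  have "delta K w = word_prod A (map (\<lambda>c. delta K [c]) w)" using assms word_prod_deltas by simp
  moreover have "set (map (\<lambda>c. delta K [c]) w) \<subseteq> gens" using assms L_lists by (auto simp: gens_def)
  ultimately show ?thesis using assms(2) unfolding products_upto_def by force
qed

lemma finite_words: "finite {w \<in> L. length w \<le> n}"
proof (rule finite_subset)
  show "{w \<in> L. length w \<le> n} \<subseteq> {w. set w \<subseteq> C \<and> length w \<le> n}" using L_lists by auto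
qed (rule finite_lists_length_le[OF finite_alphabet])

text \<open>The nonzero products of at most \<open>n\<close> letters are the monomials of these
  words, and monomials are independent.\<close>

lemma growth_function_gens:
  "growth_function K A gens n = card {w \<in> L. length w \<le> n}"
proof -
  obtain ws where ws: "set ws = {w \<in> L. length w \<le> n}" "distinct ws"
    using finite_distinct_list[OF finite_words] by blast
  have sub: "set (map (delta K) ws) \<subseteq> carrier A" using ws(1) delta_in_carrier by auto
  let ?P = "products_upto A gens n"
  note fin = finite_products_upto[OF finite_gens] and carr = products_upto_carrier[OF gens_carrier]
  have "linear_span K A ?P = ring.Span A (scalars K A) (map (delta K) ws)"
  proof
    have "?P \<subseteq> Span (scalars K A) (map (delta K) ws)"
      using products_upto_gens_subset[of n] Span_base_incl[OF subfield_scalars sub]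
        subspace_zero[OF Span_is_subalgebra[OF subfield_scalars sub]] ws(1) by auto
    then show "linear_span K A ?P \<subseteq> Span (scalars K A) (map (delta K) ws)"
      by (rule linear_span_minimal[OF fin carr Span_is_subalgebra[OF subfield_scalars sub]])
    have "set (map (delta K) ws) \<subseteq> linear_span K A ?P"
      using delta_in_products_upto linear_span_superset[OF fin carr, of n] ws(1) by auto
    then show "Span (scalars K A) (map (delta K) ws) \<subseteq> linear_span K A ?P"
      by (rule subalgebra_Span_incl[OF subfield_scalars subspace_linear_span[OF fin carr]])
  qed
  moreover have "independent (scalars K A) (map (delta K) ws)"
    using ws by (intro independent_deltas) auto
  ultimately have "dimension (length ws) (scalars K A) (linear_span K A ?P)"
    using dimension_independent[of "scalars K A" "map (delta K) ws"] by simp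
  then have "dim (scalars K A) (linear_span K A ?P) = length ws"
    using dimI[OF subfield_scalars] by (simp add: over_def)
  then show ?thesis
    using distinct_card[OF ws(2)] ws(1) by (simp add: growth_function_def)
qed

lemma generates_gens: "generates_algebra K A gens"
proof -
  let ?G = "generate_ring A (scalars K A \<union> gens)"
  have sub: "scalars K A \<union> gens \<subseteq> carrier A"
    using subfieldE(3)[OF subfield_scalars] gens_carrier by blast
  have word: "word_prod A v \<in> ?G" if "set v \<subseteq> gens" for v
    using that by (induction v) (auto simp: word_prod_def intro: generate_ring.intros)
  have "carrier A \<subseteq> ?G"
  proof (rule carrier_subset_if_deltas)
    show "\<zero>\<^bsub>A\<^esub> \<in> ?G" by (rule zero_in_generate)
    fix c w assume c: "c \<in> carrier K" and w: "w \<in> L"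
    have "set (map (\<lambda>c. delta K [c]) w) \<subseteq> gens" using w L_lists by (auto simp: gens_def)
    then have "delta K w \<in> ?G" using word[of "map (\<lambda>c. delta K [c]) w"] word_prod_deltas w by simp
    moreover have "c \<odot>\<^bsub>A\<^esub> \<one>\<^bsub>A\<^esub> \<in> ?G"
      using c by (intro generate_ring.incl) (auto simp: scalars_def)
    ultimately have "(c \<odot>\<^bsub>A\<^esub> \<one>\<^bsub>A\<^esub>) \<otimes>\<^bsub>A\<^esub> delta K w \<in> ?G" by (rule generate_ring.eng_mult[rotated])
    then show "c \<odot>\<^bsub>A\<^esub> delta K w \<in> ?G" using scalar_mult c w delta_in_carrier by simp
  qed (rule generate_ring.eng_add)
  then show ?thesis
    using generate_ring_incl[OF sub] gens_carrier unfolding generates_algebra_def by blast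
qed

lemma growth_function_equiv:
  assumes "finite S" and "generates_algebra K A S"
  shows "growth_function K A S \<sim>\<^sub>g (\<lambda>n. card {w \<in> L. length w \<le> n})"
proof -
  have "growth_function K A gens = (\<lambda>n. card {w \<in> L. length w \<le> n})"
    using growth_function_gens by blast
  then show ?thesis unfolding growth_equiv_def
    using growth_function_independent[OF assms finite_gens generates_gens]
      growth_function_independent[OF finite_gens generates_gens assms] by simp
qed

end

section \<open>Powers of the commutator\<close>

text \<open>The coefficients of \<open>(x\<^sub>0 x\<^sub>1 - x\<^sub>1 x\<^sub>0)\<^sup>m\<close>.\<close>

fun comm_power :: "('k, 'm) ring_scheme \<Rightarrow> nat \<Rightarrow> nat list \<Rightarrow> 'k"
  where
    "comm_power K 0 w = delta K [] w"
  | "comm_power K (Suc m) (i # j # w) =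
      (if i = 0 \<and> j = 1 then comm_power K m w
       else if i = 1 \<and> j = 0 then \<ominus>\<^bsub>K\<^esub> comm_power K m w else \<zero>\<^bsub>K\<^esub>)"
  | "comm_power K (Suc m) w = \<zero>\<^bsub>K\<^esub>"

text \<open>A finite set containing the support of \<open>comm_power K m\<close>; as an index set it
  splits in two just as one more commutator is expanded.\<close>

primrec comm_words :: "nat \<Rightarrow> nat list set"
  where
    "comm_words 0 = {[]}"
  | "comm_words (Suc m) = (\<lambda>w. 0 # 1 # w) ` comm_words m \<union> (\<lambda>w. 1 # 0 # w) ` comm_words m"

lemma finite_comm_words: "finite (comm_words m)"
  by (induction m) auto

lemma (in cring) comm_power_closed: "comm_power R m w \<in> carrier R"
proof (induction m arbitrary: w)
  case (Suc m)
  consider "w = []" | i where "w = [i]" | i j v where "w = i # j # v"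
    by (metis list.exhaust)
  then show ?case using Suc by cases auto
qed (simp add: delta_closed)

lemma (in cring) comm_power_support: "comm_power R m w \<noteq> \<zero> \<Longrightarrow> w \<in> comm_words m"
proof (induction m arbitrary: w)
  case (Suc m)
  consider "w = []" | i where "w = [i]" | i j v where "w = i # j # v"
    by (metis list.exhaust)
  moreover have "v \<in> comm_words m" if "\<ominus> comm_power R m v \<noteq> \<zero>" for v
    using Suc.IH[of v] that by (metis minus_zero)
  ultimately show ?case using Suc by cases (auto split: if_splits)
qed (simp add: delta_def split: if_splits)

text \<open>The alternating word \<open>[0, 1, ..., 0, 1]\<close> keeps the coefficient 1 through
  the recursion.\<close>

lemma (in domain) comm_power_nonzero: "\<exists>w. comm_power R m w \<noteq> \<zero>"
proof (induction m)
  case 0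
  have "comm_power R 0 [] \<noteq> \<zero>" by (simp add: delta_def)
  then show ?case by blast
next
  case (Suc m)
  then obtain w where "comm_power R m w \<noteq> \<zero>" by blast
  then have "comm_power R (Suc m) (0 # 1 # w) \<noteq> \<zero>" by simp
  then show ?case by blast
qed

lemma (in cring) comm_power_nc_polys: "comm_power R m \<in> nc_polys R"
proof -
  have "{w. comm_power R m w \<noteq> \<zero>} \<subseteq> comm_words m" using comm_power_support by blast
  then have "finite {w. comm_power R m w \<noteq> \<zero>}" using finite_comm_words finite_subset by blast
  then show ?thesis using comm_power_closed by (simp add: nc_polys_def)
qed

section \<open>Evaluating powers of the commutator\<close>

context field_algebra
begin

lemma nc_eval_superset:
  assumes "finite F" and "{w. p w \<noteq> \<zero>\<^bsub>K\<^esub>} \<subseteq> F" and "\<And>w. p w \<in> carrier K"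
    and "\<And>i. \<rho> i \<in> carrier A"
  shows "nc_eval K A p \<rho> = (\<Oplus>\<^bsub>A\<^esub>w\<in>F. p w \<odot>\<^bsub>A\<^esub> word_prod A (map \<rho> w))"
proof -
  have "word_prod A (map \<rho> w) \<in> carrier A" for w
    using assms(4) by (intro word_prod_closed) auto
  then show ?thesis unfolding nc_eval_def using assms
    by (intro A.add.finprod_mono_neutral_cong_left)
      (auto simp: smult_closed module.smult_l_null[OF module])
qed

lemma nc_eval_comm_power_0: "nc_eval K A (comm_power K 0) \<rho> = \<one>\<^bsub>A\<^esub>"
proof -
  have "{w. comm_power K 0 w \<noteq> \<zero>\<^bsub>K\<^esub>} = {[]}" by (auto simp: delta_def)
  then show ?thesis by (simp add: nc_eval_def delta_def word_prod_def smult_one)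
qed

text \<open>The words are split by their first two letters; each half is the sum for
  \<open>m\<close>, multiplied from the left by one of the two signed terms of the
  commutator.\<close>

lemma nc_eval_comm_power_Suc:
  assumes \<rho>: "\<And>i. \<rho> i \<in> carrier A"
  shows "nc_eval K A (comm_power K (Suc m)) \<rho>
    = (\<rho> 0 \<otimes>\<^bsub>A\<^esub> \<rho> 1 \<ominus>\<^bsub>A\<^esub> \<rho> 1 \<otimes>\<^bsub>A\<^esub> \<rho> 0) \<otimes>\<^bsub>A\<^esub> nc_eval K A (comm_power K m) \<rho>"
proof -
  let ?W = "\<lambda>w. word_prod A (map \<rho> w)" and ?p = "comm_power K"
  have W: "?W w \<in> carrier A" for w using \<rho> by (intro word_prod_closed) auto
  have sup: "nc_eval K A (?p k) \<rho> = (\<Oplus>\<^bsub>A\<^esub>w\<in>comm_words k. ?p k w \<odot>\<^bsub>A\<^esub> ?W w)" for k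
    using finite_comm_words K.comm_power_support K.comm_power_closed \<rho>
    by (intro nc_eval_superset) auto
  have cl: "?p k w \<odot>\<^bsub>A\<^esub> ?W v \<in> carrier A" for k w v
    using K.comm_power_closed W by (rule smult_closed)
  let ?E = "\<Oplus>\<^bsub>A\<^esub>w\<in>comm_words m. ?p m w \<odot>\<^bsub>A\<^esub> ?W w"
  have E: "?E \<in> carrier A" using cl by (intro A.finsum_closed) auto
  have part: "(\<Oplus>\<^bsub>A\<^esub>w\<in>(\<lambda>w. i # j # w) ` comm_words m. ?p (Suc m) w \<odot>\<^bsub>A\<^esub> ?W w)
      = x \<otimes>\<^bsub>A\<^esub> ?E"
    if x: "x \<in> carrier A"
      and eq: "\<And>w. ?p (Suc m) (i # j # w) \<odot>\<^bsub>A\<^esub> ?W (i # j # w) = x \<otimes>\<^bsub>A\<^esub> (?p m w \<odot>\<^bsub>A\<^esub> ?W w)"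
    for i j x
  proof -
    have "(\<Oplus>\<^bsub>A\<^esub>w\<in>(\<lambda>w. i # j # w) ` comm_words m. ?p (Suc m) w \<odot>\<^bsub>A\<^esub> ?W w)
        = (\<Oplus>\<^bsub>A\<^esub>w\<in>comm_words m. ?p (Suc m) (i # j # w) \<odot>\<^bsub>A\<^esub> ?W (i # j # w))"
      by (rule A.finsum_reindex) (use cl in \<open>auto simp: inj_on_def simp del: comm_power.simps list.map\<close>)
    also have "\<dots> = (\<Oplus>\<^bsub>A\<^esub>w\<in>comm_words m. x \<otimes>\<^bsub>A\<^esub> (?p m w \<odot>\<^bsub>A\<^esub> ?W w))"
      unfolding eq ..
    also have "\<dots> = x \<otimes>\<^bsub>A\<^esub> ?E"
      using cl x by (intro A.finsum_rdistr[symmetric]) (auto simp: finite_comm_words)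
    finally show ?thesis .
  qed
  have W2: "?W (i # j # w) = (\<rho> i \<otimes>\<^bsub>A\<^esub> \<rho> j) \<otimes>\<^bsub>A\<^esub> ?W w" for i j w
    using \<rho> W[of w] by (simp add: word_prod_def A.m_assoc)
  have "(\<Oplus>\<^bsub>A\<^esub>w\<in>comm_words (Suc m). ?p (Suc m) w \<odot>\<^bsub>A\<^esub> ?W w)
      = (\<Oplus>\<^bsub>A\<^esub>w\<in>(\<lambda>w. 0 # 1 # w) ` comm_words m. ?p (Suc m) w \<odot>\<^bsub>A\<^esub> ?W w)
        \<oplus>\<^bsub>A\<^esub> (\<Oplus>\<^bsub>A\<^esub>w\<in>(\<lambda>w. 1 # 0 # w) ` comm_words m. ?p (Suc m) w \<odot>\<^bsub>A\<^esub> ?W w)"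
    unfolding comm_words.simps
    by (rule A.finsum_Un_disjoint)
      (use cl in \<open>auto simp: finite_comm_words simp del: comm_power.simps list.map\<close>)
  also have "\<dots> = (\<rho> 0 \<otimes>\<^bsub>A\<^esub> \<rho> 1) \<otimes>\<^bsub>A\<^esub> ?E \<oplus>\<^bsub>A\<^esub> (\<ominus>\<^bsub>A\<^esub> (\<rho> 1 \<otimes>\<^bsub>A\<^esub> \<rho> 0)) \<otimes>\<^bsub>A\<^esub> ?E"
  proof (intro arg_cong2[where f = "\<lambda>x y. x \<oplus>\<^bsub>A\<^esub> y"] part)
    fix w
    show "?p (Suc m) (0 # 1 # w) \<odot>\<^bsub>A\<^esub> ?W (0 # 1 # w) = \<rho> 0 \<otimes>\<^bsub>A\<^esub> \<rho> 1 \<otimes>\<^bsub>A\<^esub> (?p m w \<odot>\<^bsub>A\<^esub> ?W w)"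
      unfolding W2 using W[of w] \<rho> by (simp add: smult_mult_right K.comm_power_closed)
    show "?p (Suc m) (1 # 0 # w) \<odot>\<^bsub>A\<^esub> ?W (1 # 0 # w) = \<ominus>\<^bsub>A\<^esub> (\<rho> 1 \<otimes>\<^bsub>A\<^esub> \<rho> 0) \<otimes>\<^bsub>A\<^esub> (?p m w \<odot>\<^bsub>A\<^esub> ?W w)"
      unfolding W2 using W[of w] \<rho>
      by (simp add: smult_mult_right K.comm_power_closed smult_l_minus smult_r_minus A.l_minus smult_closed)
  qed (use \<rho> in auto)
  also have "\<dots> = (\<rho> 0 \<otimes>\<^bsub>A\<^esub> \<rho> 1 \<ominus>\<^bsub>A\<^esub> \<rho> 1 \<otimes>\<^bsub>A\<^esub> \<rho> 0) \<otimes>\<^bsub>A\<^esub> ?E"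
    using \<rho> E by (simp add: A.minus_eq A.l_distr)
  finally show ?thesis unfolding sup .
qed

end

section \<open>The polynomial identity of the monomial algebra\<close>

context factorial_language
begin

text \<open>A word of \<open>L\<close> without \<open>d\<close> is a power of \<open>c\<close>,
  where convolution commutes: the algebra is commutative modulo the words containing
  \<open>d\<close>.\<close>

lemma commutator_coeff:
  assumes "L \<subseteq> lists {c, d}" and "a \<in> carrier A" and "b \<in> carrier A"
    and "count_list w d = 0"
  shows "(a \<otimes>\<^bsub>A\<^esub> b \<ominus>\<^bsub>A\<^esub> b \<otimes>\<^bsub>A\<^esub> a) w = \<zero>\<^bsub>K\<^esub>"
proof (cases "w \<in> L")
  case True
  then have "\<And>x. x \<in> set w \<Longrightarrow> x = c" using assms(1,4) by (auto simp: count_list_0_iff)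
  then have w: "w = replicate (length w) c" by (intro replicate_length_same[symmetric]) auto
  have "(a \<otimes>\<^bsub>A\<^esub> b) w = (b \<otimes>\<^bsub>A\<^esub> a) w"
    using K.conv_replicate_commute[of a b "length w" c] assms w True
    by (simp add: mult_eq coeff_closed)
  \<comment> \<open>Subtraction is rewritten as adding a multiple by minus one, because coefficients
    are known for sums and scalar multiples.\<close>
  moreover have "a \<otimes>\<^bsub>A\<^esub> b \<oplus>\<^bsub>A\<^esub> (\<ominus>\<^bsub>K\<^esub> \<one>\<^bsub>K\<^esub>) \<odot>\<^bsub>A\<^esub> (b \<otimes>\<^bsub>A\<^esub> a) = a \<otimes>\<^bsub>A\<^esub> b \<ominus>\<^bsub>A\<^esub> b \<otimes>\<^bsub>A\<^esub> a"
    using assms by (simp add: smult_l_minus smult_one minus_eq)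
  moreover have "(b \<otimes>\<^bsub>A\<^esub> a) w \<in> carrier K" using assms coeff_closed m_closed by blast
  ultimately show ?thesis
    by (metis (no_types, lifting) K.l_minus K.l_one K.one_closed K.r_neg add_eq smult_eq)
next
  case False
  then show ?thesis using assms coeff_outside[of "a \<otimes>\<^bsub>A\<^esub> b \<ominus>\<^bsub>A\<^esub> b \<otimes>\<^bsub>A\<^esub> a"] by simp
qed

text \<open>Every commutator contributes at least one \<open>d\<close> to each word of its support,
  and these counts add up under concatenation.\<close>

lemma nc_eval_comm_power_coeff:
  assumes "L \<subseteq> lists {c, d}" and \<rho>: "\<And>i. \<rho> i \<in> carrier A"
  shows "nc_eval K A (comm_power K m) \<rho> \<in> carrier A \<and>
    (\<forall>w. nc_eval K A (comm_power K m) \<rho> w \<noteq> \<zero>\<^bsub>K\<^esub> \<longrightarrow> m \<le> count_list w d)"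
proof (induction m)
  case 0
  then show ?case unfolding nc_eval_comm_power_0 by simp
next
  case (Suc m)
  let ?c = "\<rho> 0 \<otimes>\<^bsub>A\<^esub> \<rho> 1 \<ominus>\<^bsub>A\<^esub> \<rho> 1 \<otimes>\<^bsub>A\<^esub> \<rho> 0" and ?e = "nc_eval K A (comm_power K m) \<rho>"
  have c: "?c \<in> carrier A" using \<rho> by simp
  have "Suc m \<le> count_list w d" if "(?c \<otimes>\<^bsub>A\<^esub> ?e) w \<noteq> \<zero>\<^bsub>K\<^esub>" for w
  proof -
    have "conv K ?c ?e w \<noteq> \<zero>\<^bsub>K\<^esub>" using that by (simp add: mult_eq split: if_splits)
    then obtain u v where w: "w = u @ v" and u: "?c u \<noteq> \<zero>\<^bsub>K\<^esub>" and v: "?e v \<noteq> \<zero>\<^bsub>K\<^esub>"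
      using K.conv_nonzero[of ?c ?e w] coeff_closed c Suc by metis
    have "count_list u d \<noteq> 0" using u commutator_coeff[OF assms(1) \<rho> \<rho>] by blast
    moreover have "m \<le> count_list v d" using Suc v by blast
    ultimately show ?thesis using w by simp
  qed
  then show ?case unfolding nc_eval_comm_power_Suc[OF \<rho>] using Suc c by simp
qed

text \<open>The power with exponent \<open>m + 1\<close> could only be supported on words with more
  than \<open>m\<close> letters \<open>d\<close>, and \<open>L\<close> contains none.\<close>

lemma satisfies_polynomial_identity:
  assumes "L \<subseteq> lists {c, d}" and "\<And>w. w \<in> L \<Longrightarrow> count_list w d \<le> m"
  shows "satisfies_polynomial_identity K A"
  unfolding satisfies_polynomial_identity_def
proof (intro bexI conjI ballI)
  show "comm_power K (Suc m) \<in> nc_polys K" by (rule K.comm_power_nc_polys)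
  show "\<exists>w. comm_power K (Suc m) w \<noteq> \<zero>\<^bsub>K\<^esub>" by (rule K.comm_power_nonzero)
  fix \<rho> :: "nat \<Rightarrow> 'l list \<Rightarrow> 'k" assume "\<rho> \<in> UNIV \<rightarrow> carrier A"
  then have \<rho>: "\<rho> i \<in> carrier A" for i by auto
  let ?e = "nc_eval K A (comm_power K (Suc m)) \<rho>"
  have e: "?e \<in> carrier A" "\<And>w. ?e w \<noteq> \<zero>\<^bsub>K\<^esub> \<Longrightarrow> Suc m \<le> count_list w d"
    using nc_eval_comm_power_coeff[OF assms(1) \<rho>, where m = "Suc m"] by auto
  have "?e w = \<zero>\<^bsub>K\<^esub>" for w
    using e coeff_outside[OF e(1), of w] assms(2)[of w] by fastforce
  then show "?e = \<zero>\<^bsub>A\<^esub>" by (auto simp: zero_eq)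
qed

end

theorem theorem3p8:
  fixes K :: "('k, 'm) ring_scheme" and f :: "nat \<Rightarrow> nat"
  assumes "field K"
    and "characteristic K \<noteq> 2"
    and "strict_mono_on {1..} f"
    and "polynomially_bounded f"
    and "(\<lambda>n. n ^ 2) \<preceq>\<^sub>g f"
  shows "\<exists>A :: 'k word_algebra.
    assoc_algebra K A \<and>
    finitely_generated_algebra K A \<and>
    satisfies_polynomial_identity K A \<and>
    (\<forall>S. finite S \<and> generates_algebra K A S \<longrightarrow> growth_function K A S \<sim>\<^sub>g f)"
proof (rule language_with_growth[OF assms(3-5)])
  fix L :: "nat list set" and m
  assume L: "L \<subseteq> lists {0, 1}"
    and fac: "\<And>u w v. u @ w @ v \<in> L \<Longrightarrow> w \<in> L" and letters: "[0] \<in> L" "[1] \<in> L"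
    and count: "\<And>w. w \<in> L \<Longrightarrow> count_list w 1 \<le> m"
    and growth: "(\<lambda>n. card {w \<in> L. length w \<le> n}) \<sim>\<^sub>g f"
  interpret F: finite_alphabet_language K L "{0, 1}"
  proof (intro finite_alphabet_language.intro finite_alphabet_language_axioms.intro
      factorial_language.intro factorial_language_axioms.intro assms(1))
    show "[] \<in> L" using fac[of "[]" "[]" "[0]"] letters by simp
  qed (use L fac letters in auto)
  have "growth_function K F.A S \<sim>\<^sub>g f" if "finite S" "generates_algebra K F.A S" for S
    using F.growth_function_equiv[OF that] growth growth_le_trans unfolding growth_equiv_def by blast
  moreover have "finitely_generated_algebra K F.A"
    unfolding finitely_generated_algebra_def using F.finite_gens F.generates_gens by blast
  ultimately show ?thesis
    using F.assoc_algebra F.satisfies_polynomial_identity[OF L count] by blast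
qed

end
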